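(* Let $\alpha>0$ and $h_0\in\mathbb R$, and consider the Landau-Lifshitz-Gilbert equation (LLG) with constant external field intensity $h(t)\equiv h_0$. (1) If $h_0\le -1$, then the only stationary solution $w\in\mathcal H^1$ to (LLG) satisfying $\lim_{x\to-\infty}w(x)=e_1$ is the constant solution $w\equiv e_1$. (2) If $h_0=0$, then, up to the invariances, the only non-constant stationary solution $w\in\mathcal H^1$ to (LLG) satisfying $\lim_{x\to-\infty}w(x)=e_1$ is the domain wall $w_*$. (3) If $h_0\in(-1,0)$ or $h_0>0$, then there exists a non-constant stationary solution $w_{h_0}\in\mathcal H^1$ to (LLG) such that $\lim_{x\to-\infty}w_{h_0}(x)=e_1$, and it is unique up to the invariances.
   Context: $e_1,e_2,e_3$ is the canonical basis of $\mathbb R^3$, $\wedge$ the cross product, $\mathbb S^2$ the unit sphere of $\mathbb R^3$. The equation (LLG), for $m=m(t,x)=(m_1,m_2,m_3)\in\mathbb S^2$, $x\in\mathbb R$, is $$\partial_t m=m\wedge H(m)-\alpha\, m\wedge(m\wedge H(m)),\qquad H(m)=\partial_{xx}m-m_2e_2-m_3e_3+h_0e_1 .$$ $\mathcal H^1$ is the set of $m=(m_1,m_2,m_3)\in\mathscr C(\mathbb R,\mathbb S^2)$ with $\|m_2\|_{L^2}+\|m_3\|_{L^2}+\|\partial_x m\|_{L^2}<\infty$. A stationary solution $w\in\mathcal H^1$ is a time-independent solution, i.e. $w\wedge H(w)=0$ (in the sense of distributions). "Up to the invariances" means up to the action of $G=\mathbb R\times\mathbb R/2\pi\mathbb Z$: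 for $g=(y,\phi)$, $(g.w)(x)=R_\phi w(x-y)$, where $R_\phi$ is the rotation of angle $\phi$ around the axis $e_1$, $R_\phi=\begin{pmatrix}1&0&0\\0&\cos\phi&-\sin\phi\\0&\sin\phi&\cos\phi\end{pmatrix}$. The domain wall is $w_*(x)=(\cos\theta_*(x),\sin\theta_*(x),0)$ with $\theta_*(x)=2\arctan(e^x)$. *)

theory Defs
  imports "HOL-Analysis.Analysis"
begin

unbundle cross3_syntax

abbreviation e1 :: "real^3" where "e1 \<equiv> axis 1 1"
abbreviation e2 :: "real^3" where "e2 \<equiv> axis 2 1"
abbreviation e3 :: "real^3" where "e3 \<equiv> axis 3 1"

definition test_function :: "(real \<Rightarrow> real) \<Rightarrow> bool" where
  "test_function \<phi> \<longleftrightarrow>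
     (\<forall>n. (deriv ^^ n) \<phi> differentiable_on UNIV) \<and> compact (closure {x. \<phi> x \<noteq> 0})"

definition locally_integrable :: "(real \<Rightarrow> 'a::euclidean_space) \<Rightarrow> bool" where
  "locally_integrable f \<longleftrightarrow> (\<forall>a b. set_integrable lborel {a..b} f)"

definition weak_derivative ::
    "(real \<Rightarrow> 'a::euclidean_space) \<Rightarrow> (real \<Rightarrow> 'a) \<Rightarrow> bool" where
  "weak_derivative f d \<longleftrightarrow> locally_integrable f \<and> locally_integrable d \<and>
     (\<forall>\<phi>. test_function \<phi> \<longrightarrow>
        (LINT x|lborel. deriv \<phi> x *\<^sub>R f x) = - (LINT x|lborel. \<phi> x *\<^sub>R d x))"

definition in_L2 :: "(real \<Rightarrow> 'a::euclidean_space) \<Rightarrow> bool" where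
  "in_L2 f \<longleftrightarrow> f \<in> borel_measurable lborel \<and> integrable lborel (\<lambda>x. (norm (f x))\<^sup>2)"

definition H1 :: "(real \<Rightarrow> real^3) set" where
  "H1 = {m. continuous_on UNIV m \<and> range m \<subseteq> sphere 0 1 \<and>
            in_L2 (\<lambda>x. m x $ 2) \<and> in_L2 (\<lambda>x. m x $ 3) \<and>
            (\<exists>d. weak_derivative m d \<and> in_L2 d)}"

text \<open>The effective field is \<open>H(m) = \<partial>\<^sub>x\<^sub>x m + lower_field h0 m\<close>.\<close>

definition lower_field :: "real \<Rightarrow> real^3 \<Rightarrow> real^3" where
  "lower_field h0 m = - (m $ 2) *\<^sub>R e2 - (m $ 3) *\<^sub>R e3 + h0 *\<^sub>R e1"

text \<open>
  The distribution \<open>w \<and> H(w)\<close> applied to a test function \<open>\<phi>\<close>, where \<open>d\<close> is the weak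
  derivative of \<open>w\<close>. As \<open>w\<close> is locally in the Sobolev space of order one and \<open>\<partial>\<^sub>x\<^sub>x w\<close> is
  locally in its dual, the product is
  \<open>\<langle>w \<and> \<partial>\<^sub>x\<^sub>x w, \<phi>\<rangle> = - \<integral> \<partial>\<^sub>x(\<phi> w) \<and> \<partial>\<^sub>x w\<close>, with \<open>\<partial>\<^sub>x(\<phi> w) = \<phi>' w + \<phi> d\<close>.
  This is the distribution \<open>\<partial>\<^sub>x(w \<and> \<partial>\<^sub>x w)\<close>.
\<close>

definition cross_H ::
    "real \<Rightarrow> (real \<Rightarrow> real^3) \<Rightarrow> (real \<Rightarrow> real^3) \<Rightarrow> (real \<Rightarrow> real) \<Rightarrow> real^3" where
  "cross_H h0 w d \<phi> =
     - (LINT x|lborel. (deriv \<phi> x *\<^sub>R w x + \<phi> x *\<^sub>R d x) \<times> d x)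
     + (LINT x|lborel. \<phi> x *\<^sub>R (w x \<times> lower_field h0 (w x)))"

text \<open>
  A time-independent solution satisfies \<open>w \<and> H(w) = 0\<close>. The damping coefficient \<open>\<alpha>\<close> of the
  equation does not enter, by the following identity.
\<close>

lemma LLG_rhs_eq_0_iff:
  fixes m H :: "real^3"
  shows "m \<times> H - \<alpha> *\<^sub>R (m \<times> (m \<times> H)) = 0 \<longleftrightarrow> m \<times> H = 0"
proof
  assume "m \<times> H - \<alpha> *\<^sub>R (m \<times> (m \<times> H)) = 0"
  then have "(m \<times> H) \<bullet> (m \<times> H) = (m \<times> H) \<bullet> (\<alpha> *\<^sub>R (m \<times> (m \<times> H)))" by simp
  also have "\<dots> = 0" by (simp add: dot_cross_self)
  finally show "m \<times> H = 0" by simp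
qed (simp add: cross_zero_right)

definition stationary_solution :: "real \<Rightarrow> (real \<Rightarrow> real^3) \<Rightarrow> bool" where
  "stationary_solution h0 w \<longleftrightarrow>
     (\<exists>d. weak_derivative w d \<and> (\<forall>\<phi>. test_function \<phi> \<longrightarrow> cross_H h0 w d \<phi> = 0))"

definition rot :: "real \<Rightarrow> real^3^3" where
  "rot \<phi> = vector [vector [1, 0, 0],
                   vector [0, cos \<phi>, - sin \<phi>],
                   vector [0, sin \<phi>, cos \<phi>]]"

text \<open>
  The angle ranges over the reals instead of the reals modulo \<open>2\<pi>\<close>; as \<open>rot\<close> is
  \<open>2\<pi>\<close>-periodic, the orbits are the same.
\<close>

definition act :: "real \<times> real \<Rightarrow> (real \<Rightarrow> real^3) \<Rightarrow> real \<Rightarrow> real^3" where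
  "act g w = (\<lambda>x. rot (snd g) *v w (x - fst g))"

definition theta_star :: "real \<Rightarrow> real" where
  "theta_star x = 2 * arctan (exp x)"

definition domain_wall :: "real \<Rightarrow> real^3" where
  "domain_wall x = vector [cos (theta_star x), sin (theta_star x), 0]"

end

(*
A weak stationary solution w is smooth and satisfies w' = P x w, P' = - w x (lower_field h0 w) with
P = w x w'. The first coordinate of P and |P|^2 + w_1^2 + 2 h0 w_1 are conserved, and at minus
infinity w tends to e_1 and P to 0. Hence P_1 = 0 and
|w'|^2 = |P|^2 = (1 - w_1) (1 + w_1 + 2 h0). For h0 <= -1 the right-hand side is negative unless
w_1 = 1, so w is constant. By a Gronwall argument a nonconstant solution never meets e_1; its
stereographic projection z from e_1 then solves the linear equation z'' = (1 + h0) z with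
|z'|^2 = (1 + h0) |z|^2 + h0 and z parallel to z'. Up to a translation and a rotation this leaves
z = exp (- k x) - h0 / (4 k^2) exp (k x) with k^2 = 1 + h0, which for h0 = 0 is the domain wall.
*)

theory Submission
  imports Defs "HOL-Computational_Algebra.Polynomial" "HOL-Probability.Sinc_Integral" "HOL-Real_Asymp.Real_Asymp"
begin

section \<open>Test functions\<close>

text \<open>The obstacle is regularity. The equation is only tested against smooth functions, and
  two weak derivatives of \<open>w\<close> occur: the square integrable one in \<open>H1\<close> and
  the one in the equation, known to be locally integrable. What the equation controls is w x w',
  whose distributional derivative is a continuous function of \<open>w\<close>. Reading off
  pointwise statements requires concrete test functions, all built from exp (-1/x). In the linear
  problem write z = a exp (k x) + b exp (- k x) with plane vectors a and b. That z and z' are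
  parallel means that a and b are parallel; the quadratic relation becomes - 4 k^2 (a . b) = h0, the
  origin of the constant h0 / (4 k^2). The limit at minus infinity forces b \<noteq> 0, so that a
  rotation aligns b with the first axis and a translation makes it a unit vector. Geometrically the
  profile makes half a turn, from e_1 to - e_1, for h0 = 0 and a full turn through - e_1 for h0 > 0;
  for -1 < h0 < 0 it turns back before reaching - e_1.\<close>

primrec differentiable_times :: "nat \<Rightarrow> (real \<Rightarrow> real) \<Rightarrow> bool" where
  "differentiable_times 0 f \<longleftrightarrow> True"
| "differentiable_times (Suc n) f \<longleftrightarrow>
     (\<forall>x. f differentiable at x) \<and> differentiable_times n (deriv f)"

definition smooth :: "(real \<Rightarrow> real) \<Rightarrow> bool" where
  "smooth f \<longleftrightarrow> (\<forall>n. differentiable_times n f)"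

lemma differentiable_times_SucI:
  assumes "\<And>x. (f has_real_derivative f' x) (at x)" "differentiable_times n f'"
  shows "differentiable_times (Suc n) f"
proof -
  have "deriv f = f'"
    using assms(1) by (auto intro!: DERIV_imp_deriv)
  with assms show ?thesis
    by (auto simp: real_differentiable_def)
qed

lemma differentiable_times_SucE:
  assumes "differentiable_times (Suc n) f"
  shows "(f has_real_derivative deriv f x) (at x)" "differentiable_times n (deriv f)"
  using assms by (auto simp: DERIV_deriv_iff_real_differentiable)

text \<open>The recursion of \<open>differentiable_times\<close> consumes the innermost derivative
  first, which suits inductions over sums and products. This is the way back to the iterates in
  \<open>test_function\<close>.\<close>

lemma differentiable_times_funpow_deriv:
  "differentiable_times (Suc n) f \<Longrightarrow> (deriv ^^ n) f differentiable_on UNIV"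
proof (induction n arbitrary: f)
  case 0
  then show ?case
    by (auto simp: differentiable_on_def intro: differentiable_at_withinI)
next
  case (Suc n)
  then show ?case
    by (simp add: funpow_swap1 del: funpow.simps) (simp add: funpow_Suc_right del: funpow.simps)
qed

lemma differentiable_times_Suc_imp:
  "differentiable_times (Suc n) f \<Longrightarrow> differentiable_times n f"
  by (induction n arbitrary: f) auto

lemma differentiable_times_const: "differentiable_times n (\<lambda>x. c)"
  by (induction n arbitrary: c) (auto intro!: differentiable_times_SucI[where f' = "\<lambda>x. 0"] simp del: differentiable_times.simps(2))

lemma differentiable_times_add:
  "differentiable_times n f \<Longrightarrow> differentiable_times n g \<Longrightarrow> differentiable_times n (\<lambda>x. f x + g x)"
proof (induction n arbitrary: f g)
  case (Suc n)
  note f = differentiable_times_SucE[OF Suc.prems(1)] and g = differentiable_times_SucE[OF Suc.prems(2)]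
  show ?case
    by (rule differentiable_times_SucI[where f' = "\<lambda>x. deriv f x + deriv g x"])
       (auto intro!: derivative_eq_intros f g Suc.IH)
qed simp

lemma differentiable_times_mult:
  "differentiable_times n f \<Longrightarrow> differentiable_times n g \<Longrightarrow> differentiable_times n (\<lambda>x. f x * g x)"
proof (induction n arbitrary: f g)
  case (Suc n)
  note f = differentiable_times_SucE[OF Suc.prems(1)] and g = differentiable_times_SucE[OF Suc.prems(2)]
  show ?case
    by (rule differentiable_times_SucI[where f' = "\<lambda>x. deriv f x * g x + f x * deriv g x"])
       (auto intro!: derivative_eq_intros f(1) g(1) differentiable_times_add Suc.IH f(2) g(2)
          differentiable_times_Suc_imp[OF Suc.prems(1)] differentiable_times_Suc_imp[OF Suc.prems(2)])
qed simp

lemma differentiable_times_affine: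
  "differentiable_times n f \<Longrightarrow> differentiable_times n (\<lambda>x. f (a * x + b))"
proof (induction n arbitrary: f)
  case (Suc n)
  note f = differentiable_times_SucE[OF Suc.prems]
  have "((\<lambda>x. f (a * x + b)) has_real_derivative deriv f (a * x + b) * a) (at x)" for x
    by (rule DERIV_chain2[OF f(1)]) (auto intro!: derivative_eq_intros)
  then show ?case
    by (rule differentiable_times_SucI)
       (intro differentiable_times_mult differentiable_times_const Suc.IH f(2))
qed simp

lemma smooth_add: "smooth f \<Longrightarrow> smooth g \<Longrightarrow> smooth (\<lambda>x. f x + g x)"
  and smooth_mult: "smooth f \<Longrightarrow> smooth g \<Longrightarrow> smooth (\<lambda>x. f x * g x)"
  and smooth_const: "smooth (\<lambda>x. c)"
  by (simp_all add: smooth_def differentiable_times_add differentiable_times_mult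
      differentiable_times_const)

lemma smooth_diff: "smooth f \<Longrightarrow> smooth g \<Longrightarrow> smooth (\<lambda>x. f x - g x)"
  using smooth_add[of f "\<lambda>x. -1 * g x"] smooth_mult[OF smooth_const[of "-1"], of g] by simp

lemma smooth_affine: "smooth f \<Longrightarrow> smooth (\<lambda>x. f (a * x + b))"
  by (simp add: smooth_def differentiable_times_affine)

lemma smooth_antiderivative:
  assumes "\<And>x. (F has_real_derivative f x) (at x)" "smooth f"
  shows "smooth F"
  unfolding smooth_def
proof
  fix n
  show "differentiable_times n F"
    using assms by (cases n) (auto simp: smooth_def intro: differentiable_times_SucI simp del: differentiable_times.simps(2))
qed

lemma smooth_deriv: "smooth f \<Longrightarrow> smooth (deriv f)"
  unfolding smooth_def using differentiable_times_SucE(2) by blast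

lemma smooth_has_derivative: "smooth f \<Longrightarrow> (f has_real_derivative deriv f x) (at x)"
  unfolding smooth_def using differentiable_times_SucE(1) by blast

lemma test_functionI:
  assumes "smooth \<phi>" and supp: "\<And>x. \<phi> x \<noteq> 0 \<Longrightarrow> \<bar>x\<bar> \<le> R"
  shows "test_function \<phi>"
proof -
  have "{x. \<phi> x \<noteq> 0} \<subseteq> {-R..R}"
    using supp by fastforce
  then have "bounded {x. \<phi> x \<noteq> 0}"
    using bounded_closed_interval bounded_subset by blast
  then show ?thesis
    using assms(1) differentiable_times_funpow_deriv
    by (simp add: test_function_def smooth_def del: differentiable_times.simps)
qed

section \<open>Smooth functions flat at the origin\<close>

lemma poly_exp_minus_tendsto_0:
  fixes p :: "real poly"
  shows "((\<lambda>y. y ^ k * poly p y * exp (- y)) \<longlongrightarrow> 0) at_top"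
\<comment> \<open>The free power absorbs the factor \<open>y\<close> that splitting off the constant
  coefficient leaves on the tail.\<close>
proof (induction p arbitrary: k)
  case (pCons a p)
  have "((\<lambda>y. a * (y ^ k / exp y) + y ^ Suc k * poly p y * exp (- y)) \<longlongrightarrow> a * 0 + 0) at_top"
    by (intro tendsto_intros tendsto_power_div_exp_0 pCons.IH)
  then show ?case
    by (simp add: exp_minus field_simps)
qed simp

text \<open>The classical flat function exp (-1/x), with a polynomial factor in \<open>1 / x\<close>
  so that the family is closed under differentiation and smoothness becomes one induction.\<close>

definition flat :: "real poly \<Rightarrow> real \<Rightarrow> real" where
  "flat p x = (if x > 0 then poly p (1 / x) * exp (- (1 / x)) else 0)"

text \<open>With y = 1/x, differentiation in x is - y^2 times differentiation in y, and (p exp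
  (-y))' = (p' - p) exp (-y); \<open>[:0, 0, 1:]\<close> is y^2.\<close>

lemma flat_has_derivative:
  "(flat p has_real_derivative flat ([:0, 0, 1:] * (p - pderiv p)) x) (at x)"
proof -
  consider "x > 0" | "x < 0" | "x = 0" by linarith
  then show ?thesis
  proof cases
    case 1
    have "((\<lambda>x. poly p (1 / x) * exp (- (1 / x))) has_real_derivative
        flat ([:0, 0, 1:] * (p - pderiv p)) x) (at x)"
      using 1 by (auto intro!: derivative_eq_intros DERIV_chain2[OF poly_DERIV]
          simp: flat_def field_simps power2_eq_square)
    moreover have "\<forall>\<^sub>F y in nhds x. y > 0"
      using 1 order_tendstoD(1)[OF filterlim_ident] by blast
    then have "\<forall>\<^sub>F y in nhds x. flat p y = poly p (1 / y) * exp (- (1 / y))"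
      by eventually_elim (simp add: flat_def)
    ultimately show ?thesis
      by (simp add: DERIV_cong_ev[of x x "flat p", OF refl _ refl])
  next
    case 2
    have "\<forall>\<^sub>F y in nhds x. y < 0"
      using 2 order_tendstoD(2)[OF filterlim_ident] by blast
    then have "\<forall>\<^sub>F y in nhds x. flat p y = 0"
      by eventually_elim (simp add: flat_def)
    then show ?thesis
      using 2 by (simp add: DERIV_cong_ev[of x x "flat p", OF refl _ refl]) (simp add: flat_def)
  next
    case 3
    have left: "((\<lambda>h. (flat p (0 + h) - flat p 0) / h) \<longlongrightarrow> 0) (at_left 0)"
      by (rule tendsto_eventually) (auto simp: eventually_at_filter flat_def)
    \<comment> \<open>Under h = 1/y the right difference quotient at 0 is y p(y) exp (-y).\<close>
    have "((\<lambda>y. (flat p (0 + inverse y) - flat p 0) / inverse y) \<longlongrightarrow> 0) at_top"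
    proof (rule Lim_transform_eventually[OF poly_exp_minus_tendsto_0[of 1 p]])
      show "\<forall>\<^sub>F y in at_top. y ^ 1 * poly p y * exp (- y) = (flat p (0 + inverse y) - flat p 0) / inverse y"
        using eventually_gt_at_top[of "0::real"]
        by eventually_elim (simp add: flat_def divide_simps)
    qed
    then have right: "((\<lambda>h. (flat p (0 + h) - flat p 0) / h) \<longlongrightarrow> 0) (at_right 0)"
      by (simp add: filterlim_at_right_to_top)
    show ?thesis
      using filterlim_split_at[OF left right] 3 by (simp add: DERIV_def) (simp add: flat_def)
  qed
qed

lemma smooth_flat: "smooth (flat p)"
proof -
  have "differentiable_times n (flat p)" for n
    by (induction n arbitrary: p) (auto intro: differentiable_times_SucI[OF flat_has_derivative] simp del: differentiable_times.simps(2))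
  then show ?thesis by (simp add: smooth_def)
qed

section \<open>Smooth steps and their antiderivatives\<close>

lemma ex_antiderivative:
  fixes f :: "real \<Rightarrow> 'a::euclidean_space"
  assumes "continuous_on UNIV f"
  obtains F where "\<And>x. (F has_vector_derivative f x) (at x)"
  using einterval_antiderivative[of "-\<infinity>" "\<infinity>" f] assms
  by (auto simp: continuous_on_eq_continuous_at)

text \<open>\<open>T\<close> is a mollified positive part.\<close>

locale smooth_step =
  fixes S T :: "real \<Rightarrow> real"
  assumes smooth_S: "smooth S" and smooth_T: "smooth T"
    and S_le_0: "x \<le> 0 \<Longrightarrow> S x = 0" and S_ge_1: "x \<ge> 1 \<Longrightarrow> S x = 1"
    and S_nonneg: "S x \<ge> 0" and S_le_1: "S x \<le> 1"
    and T_deriv: "(T has_real_derivative S x) (at x)"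
    and T_le_0: "x \<le> 0 \<Longrightarrow> T x = 0" and T_ge_1: "x \<ge> 1 \<Longrightarrow> T x = x + (T 1 - 1)"

lemma ex_smooth_step:
  obtains S T where "smooth_step S T"
proof -
  \<comment> \<open>A bump that is positive exactly on (0, 1). Its antiderivative, normalised to run
    from 0 to 1, is \<open>S\<close>; integrating once more gives \<open>T\<close>.\<close>
  define \<rho> where "\<rho> x = flat 1 x * flat 1 (-1 * x + 1)" for x
  have \<rho>: "smooth \<rho>"
    unfolding \<rho>_def by (intro smooth_mult smooth_affine smooth_flat)
  have \<rho>_nonneg: "\<rho> x \<ge> 0" for x
    by (simp add: \<rho>_def flat_def)
  have cont: "continuous_on UNIV f" if "smooth f" for f
    using smooth_has_derivative[OF that] DERIV_isCont continuous_at_imp_continuous_on by blast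
  obtain S0 where S0: "\<And>x. (S0 has_real_derivative \<rho> x) (at x)"
    using ex_antiderivative[OF cont[OF \<rho>]] by (auto simp: has_real_derivative_iff_has_vector_derivative)
  have S0': "smooth S0" by (rule smooth_antiderivative[OF S0 \<rho>])
  have mono: "S0 x \<le> S0 y" if "x \<le> y" for x y
    by (rule DERIV_nonneg_imp_nondecreasing[OF that]) (use S0 \<rho>_nonneg in blast)
  have le0: "S0 x = S0 0" if "x \<le> 0" for x
  proof (rule antisym)
    have "S0 0 \<le> S0 x"
      by (rule DERIV_nonpos_imp_nonincreasing[OF that]) (use S0 in \<open>force simp: \<rho>_def flat_def\<close>)
    then show "S0 x \<ge> S0 0" .
  qed (use mono that in auto)
  have ge1: "S0 x = S0 1" if "x \<ge> 1" for x
  proof (rule antisym)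
    show "S0 x \<le> S0 1"
      by (rule DERIV_nonpos_imp_nonincreasing[OF that]) (use S0 in \<open>force simp: \<rho>_def flat_def\<close>)
  qed (use mono that in auto)
  have less: "S0 0 < S0 1"
  proof -
    \<comment> \<open>Strict growth is taken from the middle half, where the bump is positive up to
      and including the end points.\<close>
    have "S0 (1/4) < S0 (3/4)"
      by (rule DERIV_pos_imp_increasing) (use S0 in \<open>force simp: \<rho>_def flat_def\<close>)+
    then show ?thesis using mono[of 0 "1/4"] mono[of "3/4" 1] by simp
  qed
  define c where "c = 1 / (S0 1 - S0 0)"
  have c: "c > 0" using less by (simp add: c_def)
  define S where "S x = c * (S0 x - S0 0)" for x
  have S: "smooth S"
    unfolding S_def by (intro smooth_mult smooth_diff smooth_const S0')
  obtain T0 where T0: "\<And>x. (T0 has_real_derivative S x) (at x)"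
    using ex_antiderivative[OF cont[OF S]] by (auto simp: has_real_derivative_iff_has_vector_derivative)
  define T where "T x = T0 x - T0 0" for x
  have T: "(T has_real_derivative S x) (at x)" for x
    unfolding T_def by (auto intro!: derivative_eq_intros T0)
  have S_le0: "S x = 0" if "x \<le> 0" for x
    using le0[OF that] by (simp add: S_def)
  have S_ge1: "S x = 1" if "x \<ge> 1" for x
    using ge1[OF that] less by (simp add: S_def c_def)
  show ?thesis
  proof (rule that, unfold_locales)
    show "smooth S" "smooth T"
      using S T smooth_antiderivative by blast+
    show "x \<le> 0 \<Longrightarrow> S x = 0" "x \<ge> 1 \<Longrightarrow> S x = 1" for x
      by (fact S_le0 S_ge1)+
    show "S x \<ge> 0" for x
      using S_le0[of x] mono[of 0 x] c by (cases "x \<le> 0") (auto simp: S_def)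
    show "S x \<le> 1" for x
    proof -
      have "S0 x \<le> S0 1" using mono[of x 1] ge1[of x] by (cases "x \<le> 1") auto
      then show ?thesis using less by (simp add: S_def c_def divide_simps)
    qed
    show "(T has_real_derivative S x) (at x)" for x by (fact T)
    show "T x = 0" if "x \<le> 0" for x
    proof -
      have "\<exists>k. \<forall>y\<in>{..0}. T y = k"
        by (rule has_field_derivative_zero_constant)
           (auto intro!: has_field_derivative_at_within[OF T[THEN DERIV_cong]] simp: S_le0)
      then show ?thesis using that by (force simp: T_def)
    qed
    show "T x = x + (T 1 - 1)" if "x \<ge> 1" for x
    proof -
      have "\<exists>k. \<forall>y\<in>{1..}. T y - y = k"
        by (rule has_field_derivative_zero_constant)
           (auto intro!: derivative_eq_intros has_field_derivative_at_within[OF T] simp: S_ge1)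
      then have "T x - x = T 1 - 1" using that by force
      then show ?thesis by simp
    qed
  qed
qed

section \<open>Weak derivatives\<close>

lemma test_functionE:
  assumes "test_function \<phi>"
  obtains R where "R > 0" "\<And>x. (\<phi> has_real_derivative deriv \<phi> x) (at x)"
    "continuous_on UNIV \<phi>" "continuous_on UNIV (deriv \<phi>)"
    "\<And>x. x \<notin> {-R..R} \<Longrightarrow> \<phi> x = 0" "\<And>x. x \<notin> {-R..R} \<Longrightarrow> deriv \<phi> x = 0"
    "\<phi> R = 0" "\<phi> (-R) = 0"
proof -
  have diff: "(deriv ^^ n) \<phi> differentiable_on UNIV" for n
    using assms by (simp add: test_function_def)
  have "bounded {x. \<phi> x \<noteq> 0}"
    using assms closure_subset bounded_subset compact_imp_bounded by (metis test_function_def)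
  then obtain R0 where R0: "\<And>x. \<phi> x \<noteq> 0 \<Longrightarrow> \<bar>x\<bar> \<le> R0"
    by (auto simp: bounded_iff)
  \<comment> \<open>The margin 1 makes \<phi> vanish at \<open>R\<close> and \<open>-R\<close>
    themselves and near every point outside \<open>{-R..R}\<close>; the maximum keeps
    \<open>R\<close> positive.\<close>
  define R where "R = max R0 0 + 1"
  have \<phi>_deriv: "(\<phi> has_real_derivative deriv \<phi> x) (at x)" for x
    using diff[of 0] by (simp add: differentiable_on_def DERIV_deriv_iff_real_differentiable)
  have zero: "\<phi> x = 0" if "\<bar>x\<bar> > R0" for x
    using R0[of x] that by auto
  have "deriv \<phi> x = 0" if "x \<notin> {-R..R}" for x
  proof (rule DERIV_imp_deriv)
    have "\<forall>\<^sub>F y in nhds x. y \<in> {y. \<bar>y\<bar> > R0}"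
      by (rule eventually_nhds_in_open)
         (use that in \<open>auto intro!: open_Collect_less continuous_intros simp: R_def\<close>)
    then have "\<forall>\<^sub>F y in nhds x. \<phi> y = 0"
      by eventually_elim (simp add: zero)
    then show "(\<phi> has_real_derivative 0) (at x)"
      by (simp add: DERIV_cong_ev[of x x \<phi>, OF refl _ refl])
  qed
  moreover have "\<phi> x = 0" if "x \<notin> {-R..R}" for x
    using zero[of x] that by (auto simp: R_def)
  moreover have "continuous_on UNIV \<phi>" "continuous_on UNIV (deriv \<phi>)"
    using differentiable_imp_continuous_on[OF diff[of 0]] differentiable_imp_continuous_on[OF diff[of 1]] by auto
  moreover have "\<phi> R = 0" "\<phi> (-R) = 0" "R > 0"
    using zero by (auto simp: R_def)
  ultimately show ?thesis
    using that \<phi>_deriv by blast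
qed

lemma locally_integrable_Ioc:
  "locally_integrable f \<Longrightarrow> set_integrable lborel {a<..b} f"
  unfolding locally_integrable_def by (rule set_integrable_subset[of _ "{a..b}"]) auto

lemma locally_integrable_measurable:
  fixes f :: "real \<Rightarrow> 'a::euclidean_space"
  assumes "locally_integrable f"
  shows "f \<in> borel_measurable borel"
proof -
  have "(\<lambda>x. indicator {-real n..real n} x *\<^sub>R f x) \<in> borel_measurable lborel" for n
    using assms borel_measurable_integrable unfolding locally_integrable_def set_integrable_def by blast
  moreover have "(\<lambda>n. indicator {-real n..real n} x *\<^sub>R f x) \<longlonglongrightarrow> f x" for x
  proof (rule tendsto_eventually)
    obtain N where "\<bar>x\<bar> \<le> real N" using real_arch_simple by blast
    then have "indicator {-real n..real n} x *\<^sub>R f x = f x" if "n \<ge> N" for n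
      using that by (auto simp: indicator_def)
    then show "\<forall>\<^sub>F n in sequentially. indicator {-real n..real n} x *\<^sub>R f x = f x"
      by (rule eventually_sequentiallyI)
  qed
  ultimately have "f \<in> borel_measurable lborel"
    by (rule borel_measurable_LIMSEQ_metric)
  then show ?thesis by simp
qed

lemma locally_integrable_continuous:
  fixes f :: "real \<Rightarrow> 'a::euclidean_space"
  shows "continuous_on UNIV f \<Longrightarrow> locally_integrable f"
  unfolding locally_integrable_def
  by (meson borel_integrable_atLeastAtMost' continuous_on_subset top_greatest)

lemma integrable_dominated_Icc:
  fixes f :: "real \<Rightarrow> 'a::euclidean_space" and g :: "real \<Rightarrow> 'b::euclidean_space"
  assumes f: "locally_integrable f" and g: "g \<in> borel_measurable borel"
    and le: "\<And>x. x \<in> {a..b} \<Longrightarrow> norm (g x) \<le> C * norm (f x)"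
    and supp: "\<And>x. x \<notin> {a..b} \<Longrightarrow> g x = 0"
  shows "integrable lborel g"
proof (rule Bochner_Integration.integrable_bound)
  show "integrable lborel (\<lambda>x. C *\<^sub>R (indicator {a..b} x *\<^sub>R norm (f x)))"
    using set_integrable_norm f unfolding locally_integrable_def set_integrable_def
    by (intro integrable_scaleR_right) blast
  show "AE x in lborel. norm (g x) \<le> norm (C *\<^sub>R (indicator {a..b} x *\<^sub>R norm (f x)))"
  proof (rule AE_I2)
    fix x
    show "norm (g x) \<le> norm (C *\<^sub>R (indicator {a..b} x *\<^sub>R norm (f x)))"
      using le[of x] supp[of x] by (cases "x \<in> {a..b}") auto
  qed
qed (use g in simp)

lemma integrable_compact_support_scaleR:
  fixes f :: "real \<Rightarrow> 'a::euclidean_space"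
  assumes "locally_integrable f" "continuous_on UNIV \<phi>" and supp: "\<And>x. x \<notin> {a..b} \<Longrightarrow> \<phi> x = 0"
  shows "integrable lborel (\<lambda>x. \<phi> x *\<^sub>R f x)"
proof -
  have "compact (\<phi> ` {a..b})"
    using assms(2) continuous_on_subset by (blast intro: compact_continuous_image)
  then obtain C where C: "\<And>x. x \<in> {a..b} \<Longrightarrow> \<bar>\<phi> x\<bar> \<le> C"
    using compact_imp_bounded[of "\<phi> ` {a..b}"] unfolding bounded_iff by (metis imageI real_norm_def)
  show ?thesis
  proof (rule integrable_dominated_Icc[OF assms(1)])
    show "(\<lambda>x. \<phi> x *\<^sub>R f x) \<in> borel_measurable borel"
      using borel_measurable_continuous_onI[OF assms(2)] locally_integrable_measurable[OF assms(1)]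
      by (rule borel_measurable_scaleR)
    show "norm (\<phi> x *\<^sub>R f x) \<le> C * norm (f x)" if "x \<in> {a..b}" for x
      using C[OF that] by (simp add: mult_right_mono)
  qed (simp add: supp)
qed

lemma integral_Ioc_FTC:
  fixes F :: "real \<Rightarrow> 'a::euclidean_space"
  assumes "a \<le> b" "\<And>x. (F has_vector_derivative f x) (at x)" "continuous_on UNIV f"
  shows "(LINT x:{a<..b}|lborel. f x) = F b - F a"
proof -
  have "(LBINT x=a..b. f x) = F b - F a"
    by (rule interval_integral_FTC_finite)
       (use assms in \<open>auto intro: continuous_on_subset has_vector_derivative_at_within\<close>)
  then show ?thesis
    using assms(1) by (simp add: interval_integral_Ioc)
qed

lemma integral_by_parts_test_function:
  fixes F :: "real \<Rightarrow> 'a::euclidean_space"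
  assumes "test_function \<phi>" and F: "\<And>x. (F has_vector_derivative f x) (at x)" and f: "continuous_on UNIV f"
  shows "(LINT x|lborel. deriv \<phi> x *\<^sub>R F x) = - (LINT x|lborel. \<phi> x *\<^sub>R f x)"
proof -
  obtain R where R: "R > 0" "\<And>x. (\<phi> has_real_derivative deriv \<phi> x) (at x)"
    "continuous_on UNIV \<phi>" "continuous_on UNIV (deriv \<phi>)"
    "\<And>x. x \<notin> {-R..R} \<Longrightarrow> \<phi> x = 0" "\<And>x. x \<notin> {-R..R} \<Longrightarrow> deriv \<phi> x = 0"
    "\<phi> R = 0" "\<phi> (-R) = 0"
    by (rule test_functionE[OF assms(1)]) (rule that)
  have contF: "continuous_on UNIV F"
    using F by (meson continuous_at_imp_continuous_on has_vector_derivative_continuous)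
  have "(LINT x|lborel. deriv \<phi> x *\<^sub>R F x) + (LINT x|lborel. \<phi> x *\<^sub>R f x)
      = (LINT x|lborel. deriv \<phi> x *\<^sub>R F x + \<phi> x *\<^sub>R f x)"
    by (rule Bochner_Integration.integral_add[symmetric])
       (rule integrable_compact_support_scaleR[where a = "-R" and b = R]; use R contF f in \<open>blast intro: locally_integrable_continuous\<close>)+
  also have "\<dots> = (LINT x|lborel. indicator {-R..R} x *\<^sub>R (deriv \<phi> x *\<^sub>R F x + \<phi> x *\<^sub>R f x))"
    by (rule Bochner_Integration.integral_cong) (use R(5,6) in \<open>auto simp: indicator_def\<close>)
  also have "\<dots> = \<phi> R *\<^sub>R F R - \<phi> (-R) *\<^sub>R F (-R)"
  proof (rule integral_FTC_atLeastAtMost)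
    show "((\<lambda>x. \<phi> x *\<^sub>R F x) has_vector_derivative deriv \<phi> x *\<^sub>R F x + \<phi> x *\<^sub>R f x) (at x within {-R..R})" for x
      using has_vector_derivative_scaleR[OF has_field_derivative_at_within[OF R(2)] has_vector_derivative_at_within[OF F]]
      by (simp add: add.commute)
    show "continuous_on {-R..R} (\<lambda>x. deriv \<phi> x *\<^sub>R F x + \<phi> x *\<^sub>R f x)"
      using R(3,4) contF f by (auto intro!: continuous_intros intro: continuous_on_subset)
  qed (use R in simp)
  finally show ?thesis
    using R(7,8) by (simp add: eq_neg_iff_add_eq_0)
qed

lemma weak_derivativeI_C1:
  fixes F :: "real \<Rightarrow> 'a::euclidean_space"
  assumes "\<And>x. (F has_vector_derivative f x) (at x)" "continuous_on UNIV f"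
  shows "weak_derivative F f"
  unfolding weak_derivative_def
proof (intro conjI allI impI)
  have "continuous_on UNIV F"
    using assms(1) by (meson continuous_at_imp_continuous_on has_vector_derivative_continuous)
  then show "locally_integrable F" "locally_integrable f"
    using assms(2) by (simp_all add: locally_integrable_continuous)
qed (rule integral_by_parts_test_function[OF _ assms])

section \<open>Rescaled steps as approximate indicators and point masses\<close>

context smooth_step
begin

text \<open>Since \<open>S\<close> vanishes at 0, the limit at \<open>a\<close> itself is 0. This is
  why all intervals of integration below are open on the left and closed on the right.\<close>

lemma S_scaled_tendsto:
  "(\<lambda>n. S (real (Suc n) * (x - a))) \<longlonglongrightarrow> indicator {a<..} x"
proof (cases "x \<le> a")
  case True
  then show ?thesis
    by (simp add: S_le_0 mult_nonneg_nonpos)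
next
  case False
  obtain N where N: "1 / (x - a) < real N"
    using reals_Archimedean2 by blast
  have "S (real (Suc n) * (x - a)) = 1" if "n \<ge> N" for n
  proof (rule S_ge_1)
    have "1 = 1 / (x - a) * (x - a)" using False by simp
    also have "\<dots> \<le> real (Suc n) * (x - a)"
      using N that False by (intro mult_right_mono) auto
    finally show "1 \<le> real (Suc n) * (x - a)" .
  qed
  then show ?thesis
    using False by (auto intro!: tendsto_eventually eventually_sequentiallyI[of N])
qed

lemma continuous_S: "continuous_on UNIV S"
  using smooth_has_derivative[OF smooth_S] DERIV_isCont continuous_at_imp_continuous_on by blast

lemma continuous_deriv_S: "continuous_on UNIV (deriv S)"
  using smooth_has_derivative[OF smooth_deriv[OF smooth_S]] DERIV_isCont continuous_at_imp_continuous_on by blast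

lemma deriv_S_eq_0:
  assumes "x \<notin> {0..1}"
  shows "deriv S x = 0"
proof -
  have "\<forall>\<^sub>F y in nhds x. y \<in> - {0..1}"
    by (rule eventually_nhds_in_open) (use assms in auto)
  then have "\<forall>\<^sub>F y in nhds x. y \<notin> {0..1}" by simp
  moreover have "\<forall>\<^sub>F y in nhds x. \<bar>y - x\<bar> < \<bar>x\<bar> \<and> \<bar>y - x\<bar> < \<bar>x - 1\<bar>"
    using eventually_nhds_in_open[of "{y. \<bar>y - x\<bar> < \<bar>x\<bar>} \<inter> {y. \<bar>y - x\<bar> < \<bar>x - 1\<bar>}" x] assms
    by (force intro!: open_Collect_less continuous_intros open_Int)
  ultimately have "\<forall>\<^sub>F y in nhds x. S y = S x"
    by eventually_elim (use assms in \<open>auto simp: S_le_0 S_ge_1 not_le\<close>)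
  then have "(S has_real_derivative 0) (at x)"
    by (simp add: DERIV_cong_ev[of x x S, OF refl _ refl])
  then show ?thesis
    by (rule DERIV_imp_deriv)
qed

text \<open>The support lies in one interval for all scales \<open>k \<ge> 1\<close>, because the
  second step is complete one unit after \<open>b\<close>. This supplies the dominating function for
  the limit.\<close>

lemma box_bounds:
  assumes "a \<le> b" "k \<ge> 1"
  shows "\<bar>S (k * (x - a)) - S (k * (x - b))\<bar> \<le> 1"
    and "x \<notin> {a..b+1} \<Longrightarrow> S (k * (x - a)) - S (k * (x - b)) = 0"
proof -
  show "\<bar>S (k * (x - a)) - S (k * (x - b))\<bar> \<le> 1"
    using S_nonneg[of "k * (x - a)"] S_le_1[of "k * (x - a)"] S_nonneg[of "k * (x - b)"] S_le_1[of "k * (x - b)"]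
    by simp
  have ge: "1 \<le> k * y" if "y \<ge> 1" for y
    using mult_mono[of 1 k 1 y] that assms(2) by simp
  show "S (k * (x - a)) - S (k * (x - b)) = 0" if "x \<notin> {a..b+1}"
  proof (cases "x < a")
    case True
    then show ?thesis using assms by (simp add: S_le_0 mult_nonneg_nonpos)
  next
    case False
    then show ?thesis using assms that ge[of "x - a"] ge[of "x - b"] by (simp add: S_ge_1)
  qed
qed

lemma box_tendsto_integral:
  fixes f :: "real \<Rightarrow> 'a::euclidean_space"
  assumes f: "locally_integrable f" and "a \<le> b"
  shows "(\<lambda>n. LINT x|lborel. (S (real (Suc n) * (x - a)) - S (real (Suc n) * (x - b))) *\<^sub>R f x)
    \<longlonglongrightarrow> (LINT x:{a<..b}|lborel. f x)"
  unfolding set_lebesgue_integral_def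
proof (rule integral_dominated_convergence)
  have [measurable]: "f \<in> borel_measurable borel"
    by (rule locally_integrable_measurable[OF f])
  have [measurable]: "S \<in> borel_measurable borel"
    by (rule borel_measurable_continuous_onI[OF continuous_S])
  show "(\<lambda>x. indicator {a<..b} x *\<^sub>R f x) \<in> borel_measurable lborel" by simp
  show "(\<lambda>x. (S (real (Suc n) * (x - a)) - S (real (Suc n) * (x - b))) *\<^sub>R f x) \<in> borel_measurable lborel" for n
    by simp
  show "integrable lborel (\<lambda>x. indicator {a..b+1} x *\<^sub>R norm (f x))"
    using f set_integrable_norm unfolding locally_integrable_def set_integrable_def by blast
  show "AE x in lborel. (\<lambda>n. (S (real (Suc n) * (x - a)) - S (real (Suc n) * (x - b))) *\<^sub>R f x)
      \<longlonglongrightarrow> indicator {a<..b} x *\<^sub>R f x"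
  proof (rule AE_I2)
    fix x
    have "(\<lambda>n. (S (real (Suc n) * (x - a)) - S (real (Suc n) * (x - b))) *\<^sub>R f x)
      \<longlonglongrightarrow> (indicator {a<..} x - indicator {b<..} x) *\<^sub>R f x"
      by (intro tendsto_intros S_scaled_tendsto)
    moreover have "indicator {a<..} x - indicator {b<..} x = (indicator {a<..b} x :: real)"
      using \<open>a \<le> b\<close> by (auto simp: indicator_def)
    ultimately show "(\<lambda>n. (S (real (Suc n) * (x - a)) - S (real (Suc n) * (x - b))) *\<^sub>R f x)
      \<longlonglongrightarrow> indicator {a<..b} x *\<^sub>R f x" by simp
  qed
  show "AE x in lborel. norm ((S (real (Suc n) * (x - a)) - S (real (Suc n) * (x - b))) *\<^sub>R f x)
      \<le> indicator {a..b+1} x *\<^sub>R norm (f x)" for n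
  proof (rule AE_I2)
    fix x
    show "norm ((S (real (Suc n) * (x - a)) - S (real (Suc n) * (x - b))) *\<^sub>R f x)
      \<le> indicator {a..b+1} x *\<^sub>R norm (f x)"
      using box_bounds[of a b "real (Suc n)" x] \<open>a \<le> b\<close>
      by (cases "x \<in> {a..b+1}") (auto simp del: of_nat_Suc intro: mult_left_le_one_le)
  qed
qed

text \<open>\<open>deriv S\<close> has support in [0, 1] and total mass
  \<open>S 1 - S 0 = 1\<close>, so its rescalings form an approximate identity at \<open>a\<close>.
  The substitution u = (n + 1) (x - a) moves the scale into the continuous function, where dominated
  convergence applies.\<close>

lemma scaled_deriv_S_tendsto:
  fixes f :: "real \<Rightarrow> 'a::euclidean_space"
  assumes f: "continuous_on UNIV f"
  shows "(\<lambda>n. LINT x|lborel. (real (Suc n) * deriv S (real (Suc n) * (x - a))) *\<^sub>R f x) \<longlonglongrightarrow> f a"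
proof -
  have "compact (f ` {a..a+1})"
    using f continuous_on_subset by (blast intro: compact_continuous_image)
  then obtain C where C: "\<And>x. x \<in> {a..a+1} \<Longrightarrow> norm (f x) \<le> C"
    using compact_imp_bounded[of "f ` {a..a+1}"] unfolding bounded_iff by (metis imageI)
  have "(LINT x|lborel. (real (Suc n) * deriv S (real (Suc n) * (x - a))) *\<^sub>R f x)
      = (LINT u|lborel. deriv S u *\<^sub>R f (a + u / real (Suc n)))" for n
    by (subst lborel_integral_real_affine[where c = "1 / real (Suc n)" and t = a])
       (simp_all del: of_nat_Suc flip: integral_scaleR_right)
  moreover have "(\<lambda>n. LINT u|lborel. deriv S u *\<^sub>R f (a + u / real (Suc n)))
      \<longlonglongrightarrow> (LINT u|lborel. deriv S u *\<^sub>R f a)"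
  proof (rule integral_dominated_convergence[where w = "\<lambda>u. norm (deriv S u *\<^sub>R C)"])
    have [measurable]: "f \<in> borel_measurable borel" "deriv S \<in> borel_measurable borel"
      by (intro borel_measurable_continuous_onI f continuous_deriv_S)+
    show "(\<lambda>u. deriv S u *\<^sub>R f a) \<in> borel_measurable lborel"
      "(\<lambda>u. deriv S u *\<^sub>R f (a + u / real (Suc n))) \<in> borel_measurable lborel" for n
      by simp_all
    show "integrable lborel (\<lambda>u. norm (deriv S u *\<^sub>R C))"
      using integrable_compact_support_scaleR[OF locally_integrable_continuous[OF continuous_on_const] continuous_deriv_S, of 0 1 C]
        deriv_S_eq_0 by (intro integrable_norm) blast
    show "AE u in lborel. (\<lambda>n. deriv S u *\<^sub>R f (a + u / real (Suc n))) \<longlonglongrightarrow> deriv S u *\<^sub>R f a"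
    proof (rule AE_I2)
      fix u
      have "(\<lambda>n. a + u * (1 / real (Suc n))) \<longlonglongrightarrow> a + u * 0"
        by (intro tendsto_intros LIMSEQ_Suc[OF lim_1_over_n])
      then show "(\<lambda>n. deriv S u *\<^sub>R f (a + u / real (Suc n))) \<longlonglongrightarrow> deriv S u *\<^sub>R f a"
        by (intro tendsto_intros isCont_tendsto_compose[where g = f])
           (use f in \<open>auto simp: continuous_on_eq_continuous_at simp del: of_nat_Suc\<close>)
    qed
    show "AE u in lborel. norm (deriv S u *\<^sub>R f (a + u / real (Suc n))) \<le> norm (deriv S u *\<^sub>R C)" for n
    proof (rule AE_I2)
      fix u
      show "norm (deriv S u *\<^sub>R f (a + u / real (Suc n))) \<le> norm (deriv S u *\<^sub>R C)"
      proof (cases "u \<in> {0..1}")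
        case True
        then have "u / real (Suc n) \<le> 1 / 1"
          by (intro frac_le) auto
        then have "norm (f (a + u / real (Suc n))) \<le> C"
          using True by (intro C) (auto simp del: of_nat_Suc)
        then show ?thesis
          using abs_ge_self[of C] by (auto simp: abs_mult simp del: of_nat_Suc intro!: mult_left_mono)
      qed (simp add: deriv_S_eq_0)
    qed
  qed
  moreover have "(LINT u|lborel. deriv S u *\<^sub>R f a) = f a"
  proof -
    have "(LINT u|lborel. deriv S u *\<^sub>R f a) = (LINT u|lborel. indicator {0..1} u *\<^sub>R (deriv S u *\<^sub>R f a))"
      by (rule Bochner_Integration.integral_cong) (use deriv_S_eq_0 in \<open>force simp: indicator_def\<close>)+
    also have "\<dots> = S 1 *\<^sub>R f a - S 0 *\<^sub>R f a"
    proof (rule integral_FTC_atLeastAtMost)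
      show "((\<lambda>u. S u *\<^sub>R f a) has_vector_derivative deriv S u *\<^sub>R f a) (at u within {0..1})" for u
        using has_vector_derivative_scaleR[OF has_field_derivative_at_within[OF smooth_has_derivative[OF smooth_S]]
            has_vector_derivative_const] by simp
      show "continuous_on {0..1} (\<lambda>u. deriv S u *\<^sub>R f a)"
        using continuous_deriv_S by (auto intro!: continuous_intros intro: continuous_on_subset)
    qed simp
    finally show ?thesis
      by (simp add: S_le_0 S_ge_1)
  qed
  ultimately show ?thesis
    by (simp only:)
qed

end

text \<open>Test with smooth approximations of the indicator of (a, b]: paired with \<open>d\<close>
  they give its integral, while their derivatives tend to the point mass at \<open>a\<close> minus
  the one at \<open>b\<close>.\<close>

lemma weak_derivative_increment:
  fixes f :: "real \<Rightarrow> 'a::euclidean_space"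
  assumes wd: "weak_derivative f d" and f: "continuous_on UNIV f" and ab: "a \<le> b"
  shows "(LINT x:{a<..b}|lborel. d x) = f b - f a"
proof -
  obtain S T where "smooth_step S T" by (rule ex_smooth_step)
  then interpret smooth_step S T .
  define \<phi> where "\<phi> n x = S (real (Suc n) * (x - a)) - S (real (Suc n) * (x - b))" for n x
  have scaled: "smooth (\<lambda>x. S (k * (x - c)))" for k c
    using smooth_affine[OF smooth_S, of k "- (k * c)"] by (simp add: algebra_simps)
  have test: "test_function (\<phi> n)" for n
  proof (rule test_functionI)
    show "smooth (\<phi> n)"
      unfolding \<phi>_def by (intro smooth_diff scaled)
    show "\<bar>x\<bar> \<le> max \<bar>a\<bar> \<bar>b + 1\<bar>" if "\<phi> n x \<noteq> 0" for x
      using that box_bounds(2)[OF ab, of "real (Suc n)" x] by (cases "x \<in> {a..b+1}") (auto simp: \<phi>_def)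
  qed
  have deriv_\<phi>: "deriv (\<phi> n) x = real (Suc n) * deriv S (real (Suc n) * (x - a))
      - real (Suc n) * deriv S (real (Suc n) * (x - b))" for n x
  proof (rule DERIV_imp_deriv)
    have "((\<lambda>x. S (k * (x - c))) has_real_derivative deriv S (k * (x - c)) * k) (at x)" for k c x
      by (rule DERIV_chain2[OF smooth_has_derivative[OF smooth_S]]) (auto intro!: derivative_eq_intros)
    from DERIV_diff[OF this[of "real (Suc n)" a] this[of "real (Suc n)" b]]
    show "(\<phi> n has_real_derivative real (Suc n) * deriv S (real (Suc n) * (x - a))
      - real (Suc n) * deriv S (real (Suc n) * (x - b))) (at x)"
      unfolding \<phi>_def by (simp add: mult.commute del: of_nat_Suc)
  qed
  have int: "integrable lborel (\<lambda>x. (real (Suc n) * deriv S (real (Suc n) * (x - c))) *\<^sub>R f x)" for n c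
  proof (rule integrable_compact_support_scaleR[OF locally_integrable_continuous[OF f]])
    show "continuous_on UNIV (\<lambda>x. real (Suc n) * deriv S (real (Suc n) * (x - c)))"
      by (intro continuous_intros continuous_on_compose2[OF continuous_deriv_S]) auto
    show "real (Suc n) * deriv S (real (Suc n) * (x - c)) = 0" if "x \<notin> {c..c+1}" for x
    proof -
      have "real (Suc n) * (x - c) \<notin> {0..1}"
      proof (cases "x < c")
        case True
        then show ?thesis by (simp add: zero_le_mult_iff del: of_nat_Suc)
      next
        case False
        then have "1 < x - c" using that by simp
        then have "1 * 1 < real (Suc n) * (x - c)"
          by (intro mult_le_less_imp_less) auto
        then show ?thesis by simp
      qed
      then show ?thesis by (metis deriv_S_eq_0 mult_zero_right)
    qed
  qed
  have "(LINT x|lborel. \<phi> n x *\<^sub>R d x) = (LINT x|lborel. (real (Suc n) * deriv S (real (Suc n) * (x - b))) *\<^sub>R f x)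
      - (LINT x|lborel. (real (Suc n) * deriv S (real (Suc n) * (x - a))) *\<^sub>R f x)" for n
  proof -
    have "(LINT x|lborel. \<phi> n x *\<^sub>R d x) = - (LINT x|lborel. deriv (\<phi> n) x *\<^sub>R f x)"
      using wd test[of n] by (simp add: weak_derivative_def)
    also have "\<dots> = - ((LINT x|lborel. (real (Suc n) * deriv S (real (Suc n) * (x - a))) *\<^sub>R f x)
      - (LINT x|lborel. (real (Suc n) * deriv S (real (Suc n) * (x - b))) *\<^sub>R f x))"
      by (simp only: deriv_\<phi> scaleR_diff_left Bochner_Integration.integral_diff[OF int int])
    finally show ?thesis by simp
  qed
  moreover have "(\<lambda>n. LINT x|lborel. \<phi> n x *\<^sub>R d x) \<longlonglongrightarrow> (LINT x:{a<..b}|lborel. d x)"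
    unfolding \<phi>_def by (rule box_tendsto_integral) (use wd ab in \<open>auto simp: weak_derivative_def\<close>)
  ultimately show ?thesis
    using LIMSEQ_unique tendsto_diff[OF scaled_deriv_S_tendsto[OF f, of b] scaled_deriv_S_tendsto[OF f, of a]]
    by force
qed

text \<open>With \<open>T\<^sub>n x = T (n x) / n\<close>, the function
  \<open>T\<^sub>n (x - a) - T\<^sub>n (x - b) - (b - a) (T\<^sub>n x - T\<^sub>n (x - 1))\<close> has compact support, and its derivative
  tends boundedly to the indicator of \<open>(a, b]\<close> minus \<open>b - a\<close> times that of \<open>(0, 1]\<close>.\<close>

lemma weak_derivative_continuous_imp:
  fixes f :: "real \<Rightarrow> 'a::euclidean_space"
  assumes wd: "weak_derivative f g" and g: "continuous_on UNIV g"
  obtains P where "\<And>x. (P has_vector_derivative g x) (at x)"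
    "\<And>a b. a \<le> b \<Longrightarrow> (LINT x:{a<..b}|lborel. f x) = (LINT x:{a<..b}|lborel. P x)"
proof -
  obtain S T where "smooth_step S T" by (rule ex_smooth_step)
  then interpret smooth_step S T .
  obtain G where G: "\<And>x. (G has_vector_derivative g x) (at x)"
    by (rule ex_antiderivative[OF g]) (rule that)
  have contG: "continuous_on UNIV G"
    using G by (meson continuous_at_imp_continuous_on has_vector_derivative_continuous)
  have lf: "locally_integrable f" and lG: "locally_integrable G"
    using wd contG by (auto simp: weak_derivative_def intro: locally_integrable_continuous)
  \<comment> \<open>\<open>F\<close> has weak derivative 0 and so should be a constant. Weak
    derivatives only see \<open>f\<close> up to null sets, so constancy is expressed through
    integrals over intervals; the constant is the integral over the reference interval (0,
    1].\<close>
  define F where "F x = f x - G x" for x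
  have lF: "locally_integrable F"
    using lf lG set_integral_diff(1) unfolding locally_integrable_def F_def by blast
  have F0: "(LINT x|lborel. deriv \<phi> x *\<^sub>R F x) = 0" if \<phi>: "test_function \<phi>" for \<phi>
  proof -
    obtain R where R: "R > 0" "\<And>x. (\<phi> has_real_derivative deriv \<phi> x) (at x)"
      "continuous_on UNIV \<phi>" "continuous_on UNIV (deriv \<phi>)"
      "\<And>x. x \<notin> {-R..R} \<Longrightarrow> \<phi> x = 0" "\<And>x. x \<notin> {-R..R} \<Longrightarrow> deriv \<phi> x = 0"
      "\<phi> R = 0" "\<phi> (-R) = 0"
      by (rule test_functionE[OF \<phi>]) (rule that)
    have "(LINT x|lborel. deriv \<phi> x *\<^sub>R F x) = (LINT x|lborel. deriv \<phi> x *\<^sub>R f x) - (LINT x|lborel. deriv \<phi> x *\<^sub>R G x)"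
      unfolding F_def scaleR_diff_right
      by (rule Bochner_Integration.integral_diff)
         (rule integrable_compact_support_scaleR[where a = "-R" and b = R]; use lf lG R in blast)+
    also have "\<dots> = 0"
      using wd \<phi> integral_by_parts_test_function[OF \<phi> G g] by (simp add: weak_derivative_def)
    finally show ?thesis .
  qed
  define c where "c = (LINT x:{0<..1}|lborel. F x)"
  have "(LINT x:{a<..b}|lborel. F x) = (b - a) *\<^sub>R c" if ab: "a \<le> b" for a b
  proof -
    define \<phi> where "\<phi> n x = 1 / real (Suc n) * (T (real (Suc n) * (x - a)) - T (real (Suc n) * (x - b))
        - (b - a) * (T (real (Suc n) * (x - 0)) - T (real (Suc n) * (x - 1))))" for n x
    have scaled: "smooth (\<lambda>x. T (k * (x - c)))" for k c
      using smooth_affine[OF smooth_T, of k "- (k * c)"] by (simp add: algebra_simps)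
    have test: "test_function (\<phi> n)" for n
    proof (rule test_functionI)
      show "smooth (\<phi> n)"
        unfolding \<phi>_def by (intro smooth_mult smooth_diff smooth_const scaled)
      show "\<bar>x\<bar> \<le> \<bar>a\<bar> + \<bar>b\<bar> + 2" if "\<phi> n x \<noteq> 0" for x
      proof (rule ccontr)
        assume x: "\<not> ?thesis"
        show False
        proof (cases "x < 0")
          case True
          then have "x - a \<le> 0" "x - b \<le> 0" "x - 0 \<le> 0" "x - 1 \<le> 0" using x by auto
          then have "\<phi> n x = 0"
            unfolding \<phi>_def by (simp add: T_le_0 mult_nonneg_nonpos del: of_nat_Suc)
          with that show False by simp
        next
          case False
          have ge: "1 \<le> real (Suc n) * y" if "y \<ge> 1" for y
            using mult_mono[of 1 "real (Suc n)" 1 y] that by simp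
          have "x - a \<ge> 1" "x - b \<ge> 1" "x - 0 \<ge> 1" "x - 1 \<ge> 1" using False x by auto
          \<comment> \<open>To the right of every transition each \<open>T\<close> equals its
            argument plus \<open>T 1 - 1\<close>. These constants cancel in pairs, and what remains
            is n (b - a) - (b - a) n for the scale n.\<close>
          note T_eq = this[THEN ge, THEN T_ge_1]
          have "\<phi> n x = 0"
            unfolding \<phi>_def T_eq by (simp add: algebra_simps)
          with that show False by simp
        qed
      qed
    qed
    define box where "box n u v x = S (real (Suc n) * (x - u)) - S (real (Suc n) * (x - v))" for n u v x
    have deriv_\<phi>: "deriv (\<phi> n) x = box n a b x - (b - a) * box n 0 1 x" for n x
    proof (rule DERIV_imp_deriv)
      have T': "((\<lambda>x. T (k * (x - c))) has_real_derivative S (k * (x - c)) * k) (at x)" for k c x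
        by (rule DERIV_chain2[OF T_deriv]) (auto intro!: derivative_eq_intros)
      show "(\<phi> n has_real_derivative box n a b x - (b - a) * box n 0 1 x) (at x)"
        unfolding \<phi>_def box_def
        by (rule DERIV_cong[OF DERIV_cmult[OF DERIV_diff[OF DERIV_diff[OF T' T'] DERIV_cmult[OF DERIV_diff[OF T' T']]]]])
           (simp add: divide_simps algebra_simps del: of_nat_Suc)
    qed
    have int: "integrable lborel (\<lambda>x. box n u v x *\<^sub>R F x)" if "u \<le> v" for n u v
    proof (rule integrable_compact_support_scaleR[OF lF])
      show "continuous_on UNIV (box n u v)"
        unfolding box_def by (intro continuous_intros continuous_on_compose2[OF continuous_S]) auto
      show "box n u v x = 0" if "x \<notin> {u..v+1}" for x
        using box_bounds(2)[OF \<open>u \<le> v\<close> _ that, of "real (Suc n)"] by (simp add: box_def)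
    qed
    have "(LINT x|lborel. box n a b x *\<^sub>R F x) - (b - a) *\<^sub>R (LINT x|lborel. box n 0 1 x *\<^sub>R F x) = 0" for n
    proof -
      have "(LINT x|lborel. box n a b x *\<^sub>R F x) - (b - a) *\<^sub>R (LINT x|lborel. box n 0 1 x *\<^sub>R F x)
        = (LINT x|lborel. box n a b x *\<^sub>R F x - (b - a) *\<^sub>R (box n 0 1 x *\<^sub>R F x))"
        by (subst Bochner_Integration.integral_diff)
           (auto intro!: int ab integrable_scaleR_right simp del: scaleR_scaleR)
      also have "\<dots> = (LINT x|lborel. deriv (\<phi> n) x *\<^sub>R F x)"
        by (simp add: deriv_\<phi> algebra_simps)
      finally show ?thesis using F0[OF test] by simp
    qed
    moreover have "(\<lambda>n. (LINT x|lborel. box n a b x *\<^sub>R F x) - (b - a) *\<^sub>R (LINT x|lborel. box n 0 1 x *\<^sub>R F x))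
      \<longlonglongrightarrow> (LINT x:{a<..b}|lborel. F x) - (b - a) *\<^sub>R (LINT x:{0<..1}|lborel. F x)"
      unfolding box_def by (intro tendsto_intros box_tendsto_integral lF ab) simp
    ultimately show ?thesis
      using LIMSEQ_unique[OF _ tendsto_const] by (force simp: c_def)
  qed
  then have F_int: "(LINT x:{a<..b}|lborel. F x) = (LINT x:{a<..b}|lborel. c)" if "a \<le> b" for a b
    using that by (simp add: set_lebesgue_integral_def)
  show ?thesis
  proof
    show "((\<lambda>x. G x + c) has_vector_derivative g x) (at x)" for x
      using has_vector_derivative_add_const G by blast
    show "(LINT x:{a<..b}|lborel. f x) = (LINT x:{a<..b}|lborel. G x + c)" if "a \<le> b" for a b
    proof -
      have c: "set_integrable lborel {a<..b} (\<lambda>x. c)"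
        by (intro locally_integrable_Ioc locally_integrable_continuous continuous_on_const)
      have "(LINT x:{a<..b}|lborel. f x) = (LINT x:{a<..b}|lborel. G x + F x)"
        by (simp add: F_def)
      also have "\<dots> = (LINT x:{a<..b}|lborel. G x) + (LINT x:{a<..b}|lborel. F x)"
        by (intro set_integral_add(2) locally_integrable_Ioc lG lF)
      also have "\<dots> = (LINT x:{a<..b}|lborel. G x + c)"
        by (simp add: F_int[OF that] set_integral_add(2)[OF locally_integrable_Ioc[OF lG] c])
      finally show ?thesis .
    qed
  qed
qed

section \<open>Regularity of stationary solutions\<close>

lemma norm_cross_le: "norm (x \<times> y) \<le> norm x * norm y" for x y :: "real^3"
proof -
  have "(norm (x \<times> y))\<^sup>2 \<le> (norm x * norm y)\<^sup>2"
    using norm_cross_dot[of x y] zero_le_power2[of "x \<bullet> y"] by linarith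
  then show ?thesis
    by (rule power2_le_imp_le) simp
qed

lemma bounded_bilinear_cross: "bounded_bilinear (\<lambda>x y :: real^3. x \<times> y)"
  using bilinear_cross bilinear_conv_bounded_bilinear by blast

lemma locally_integrable_cross:
  fixes u v :: "real \<Rightarrow> real^3"
  assumes v: "continuous_on UNIV v" and u: "locally_integrable u"
  shows "locally_integrable (\<lambda>x. v x \<times> u x)"
  unfolding locally_integrable_def set_integrable_def
proof (intro allI)
  fix a b :: real
  have "compact (v ` {a..b})"
    using v continuous_on_subset by (blast intro: compact_continuous_image)
  then obtain C where C: "\<And>x. x \<in> {a..b} \<Longrightarrow> norm (v x) \<le> C"
    using compact_imp_bounded[of "v ` {a..b}"] unfolding bounded_iff by (metis imageI)
  show "integrable lborel (\<lambda>x. indicator {a..b} x *\<^sub>R (v x \<times> u x))"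
  proof (rule integrable_dominated_Icc[OF u])
    have "(\<lambda>x. v x \<times> u x) \<in> borel_measurable borel"
      by (rule borel_measurable_continuous_Pair[OF borel_measurable_continuous_onI[OF v] locally_integrable_measurable[OF u]])
         (intro continuous_intros continuous_on_cross)
    then show "(\<lambda>x. indicator {a..b} x *\<^sub>R (v x \<times> u x)) \<in> borel_measurable borel"
      by simp
    show "norm (indicator {a..b} x *\<^sub>R (v x \<times> u x)) \<le> C * norm (u x)" if "x \<in> {a..b}" for x
      using order_trans[OF norm_cross_le mult_right_mono[OF C[OF that] norm_ge_zero]] that by simp
  qed simp
qed

lemma set_integral_Ioc_combine:
  fixes f :: "real \<Rightarrow> 'a::euclidean_space"
  assumes "locally_integrable f" "a \<le> b" "b \<le> c"
  shows "(LINT x:{a<..c}|lborel. f x) = (LINT x:{a<..b}|lborel. f x) + (LINT x:{b<..c}|lborel. f x)"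
proof -
  have "{a<..c} = {a<..b} \<union> {b<..c}" using assms by auto
  then show ?thesis
    using assms by (simp add: set_integral_Un locally_integrable_Ioc)
qed

lemma set_integral_cross_left:
  fixes u :: "real \<Rightarrow> real^3"
  assumes "locally_integrable u"
  shows "(LINT x:{a<..b}|lborel. v \<times> u x) = v \<times> (LINT x:{a<..b}|lborel. u x)"
proof -
  have "bounded_linear (\<lambda>y. v \<times> y)"
    by (rule bounded_bilinear.bounded_linear_right[OF bounded_bilinear_cross])
  moreover have "integrable lborel (\<lambda>x. indicator {a<..b} x *\<^sub>R u x)"
    using locally_integrable_Ioc[OF assms] by (simp add: set_integrable_def)
  ultimately have "(LINT x|lborel. v \<times> (indicator {a<..b} x *\<^sub>R u x))
      = v \<times> (LINT x|lborel. indicator {a<..b} x *\<^sub>R u x)"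
    by (rule integral_bounded_linear)
  then show ?thesis
    by (simp add: set_lebesgue_integral_def cross_mult_right)
qed

lemma set_integral_norm_le:
  fixes f :: "real \<Rightarrow> 'a::euclidean_space" and g :: "real \<Rightarrow> real"
  assumes "locally_integrable f" "locally_integrable g" "\<And>x. x \<in> {a<..b} \<Longrightarrow> norm (f x) \<le> g x"
  shows "norm (LINT x:{a<..b}|lborel. f x) \<le> (LINT x:{a<..b}|lborel. g x)"
  unfolding set_lebesgue_integral_def
proof (rule Bochner_Integration.integral_norm_bound_integral)
  show "norm (indicator {a<..b} x *\<^sub>R f x) \<le> indicator {a<..b} x *\<^sub>R g x" for x
    using assms(3)[of x] by (cases "x \<in> {a<..b}") simp_all
qed (use locally_integrable_Ioc[OF assms(1)] locally_integrable_Ioc[OF assms(2)] in \<open>simp_all add: set_integrable_def\<close>)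

lemma locally_integrable_norm:
  "locally_integrable f \<Longrightarrow> locally_integrable (\<lambda>x. norm (f x))"
  unfolding locally_integrable_def using set_integrable_norm by fast

lemma set_integral_cross_eq_0:
  fixes u v :: "real \<Rightarrow> real^3"
  assumes v: "continuous_on UNIV v" and u: "locally_integrable u"
    and zero: "\<And>a b. a \<le> b \<Longrightarrow> (LINT x:{a<..b}|lborel. u x) = 0"
    and ab: "a \<le> b"
  shows "(LINT x:{a<..b}|lborel. v x \<times> u x) = 0"
proof -
  let ?I = "\<lambda>s t. LINT x:{s<..t}|lborel. v x \<times> u x" and ?N = "\<lambda>s t. LINT x:{s<..t}|lborel. norm (u x)"
  note vu = locally_integrable_cross[OF v u] and nu = locally_integrable_norm[OF u]
  have "norm (?I a b) \<le> e * ?N a b" if "e > 0" for e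
    using ab
  proof (induction rule: Bolzano)
    case (trans r s t)
    have "norm (?I r t) \<le> norm (?I r s) + norm (?I s t)"
      unfolding set_integral_Ioc_combine[OF vu trans(3,4)] by (rule norm_triangle_ineq)
    also have "\<dots> \<le> e * ?N r t"
      using trans(1,2) by (simp add: set_integral_Ioc_combine[OF nu trans(3,4)] distrib_left)
    finally show ?case .
  next
    case (local y)
    have "isCont v y" using v by (simp add: continuous_on_eq_continuous_at)
    then obtain \<delta> where \<delta>: "\<delta> > 0" "\<And>x. \<bar>x - y\<bar> < \<delta> \<Longrightarrow> norm (v x - v y) < e"
      using \<open>e > 0\<close> unfolding continuous_at_eps_delta by (metis dist_norm real_norm_def)
    have "norm (?I s t) \<le> e * ?N s t" if st: "s \<le> y" "y \<le> t" "t - s < \<delta>" for s t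
    proof -
      have vy: "continuous_on UNIV (\<lambda>x. v x - v y)"
        by (intro continuous_intros v)
      have "?I s t = (LINT x:{s<..t}|lborel. v x \<times> u x) - v y \<times> (LINT x:{s<..t}|lborel. u x)"
        using zero[of s t] st by simp
      also have "\<dots> = (LINT x:{s<..t}|lborel. v x \<times> u x - v y \<times> u x)"
        using u vu by (simp add: set_integral_cross_left[symmetric] set_integral_diff(2) locally_integrable_Ioc
            locally_integrable_cross)
      also have "\<dots> = (LINT x:{s<..t}|lborel. (v x - v y) \<times> u x)"
        by (simp add: bounded_bilinear.diff_left[OF bounded_bilinear_cross])
      also have "norm \<dots> \<le> (LINT x:{s<..t}|lborel. e * norm (u x))"
      proof (rule set_integral_norm_le)
        show "locally_integrable (\<lambda>x. e * norm (u x))"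
          using nu by (auto simp: locally_integrable_def)
        show "norm ((v x - v y) \<times> u x) \<le> e * norm (u x)" if "x \<in> {s<..t}" for x
          using norm_cross_le[of "v x - v y" "u x"] \<delta>(2)[of x] that st
          by (force intro: order_trans mult_right_mono)
      qed (rule locally_integrable_cross[OF vy u])
      finally show ?thesis by simp
    qed
    then show ?case using \<delta>(1) by blast
  qed
  note bound = this
  have "norm (?I a b) \<le> 0 + e" if "e > 0" for e
  proof -
    have N: "?N a b \<ge> 0"
      unfolding set_lebesgue_integral_def by (rule Bochner_Integration.integral_nonneg) simp
    \<comment> \<open>The added 1 keeps the denominator positive when the integral of
      \<open>norm (u x)\<close> vanishes.\<close>
    have "norm (?I a b) \<le> e / (?N a b + 1) * ?N a b"
      using bound[of "e / (?N a b + 1)"] that N by simp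
    also have "\<dots> \<le> e"
      using that N by (simp add: divide_simps)
    finally show ?thesis by simp
  qed
  then have "norm (?I a b) \<le> 0"
    by (rule field_le_epsilon)
  then show ?thesis by simp
qed

text \<open>With \<open>m\<close> the mean of \<open>norm (d x)\<close> over the interval, this says
  that the variance is nonnegative.\<close>

lemma Cauchy_Schwarz_set_integral_Ioc:
  fixes d :: "real \<Rightarrow> 'a::euclidean_space"
  assumes d: "locally_integrable d" and d2: "locally_integrable (\<lambda>x. (norm (d x))\<^sup>2)" and st: "s \<le> t"
  shows "(LINT x:{s<..t}|lborel. norm (d x))\<^sup>2 \<le> (t - s) * (LINT x:{s<..t}|lborel. (norm (d x))\<^sup>2)"
proof (cases "s = t")
  case False
  let ?N = "LINT x:{s<..t}|lborel. norm (d x)" and ?I = "LINT x:{s<..t}|lborel. (norm (d x))\<^sup>2"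
  define m where "m = ?N / (t - s)"
  have int: "set_integrable lborel {s<..t} (\<lambda>x. norm (d x))" "set_integrable lborel {s<..t} (\<lambda>x. (norm (d x))\<^sup>2)"
    "set_integrable lborel {s<..t} (\<lambda>x. m\<^sup>2)"
    by (intro locally_integrable_Ioc locally_integrable_norm d d2 locally_integrable_continuous continuous_on_const)+
  have "0 \<le> (LINT x:{s<..t}|lborel. (norm (d x) - m)\<^sup>2)"
    unfolding set_lebesgue_integral_def by (rule Bochner_Integration.integral_nonneg) simp
  also have "\<dots> = (LINT x:{s<..t}|lborel. (norm (d x))\<^sup>2 - 2 * m * norm (d x) + m\<^sup>2)"
    by (simp add: power2_diff algebra_simps)
  also have "\<dots> = ?I - 2 * m * ?N + (LINT x:{s<..t}|lborel. m\<^sup>2)"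
    using int by (simp add: set_integral_add(2) set_integral_diff(2))
  also have "(LINT x:{s<..t}|lborel. m\<^sup>2) = m\<^sup>2 * (t - s)"
    using st by (simp add: set_lebesgue_integral_def)
  finally have nonneg: "0 \<le> (t - s) * (?I - 2 * m * ?N + m\<^sup>2 * (t - s))"
    using st by simp
  have "m * (t - s) = ?N"
    using False by (simp add: m_def)
  moreover have "h * (i - 2 * m * n + m\<^sup>2 * h) = h * i - n\<^sup>2" if "m * h = n" for h i n :: real
    using that by (auto simp: power2_eq_square algebra_simps)
  ultimately have "(t - s) * (?I - 2 * m * ?N + m\<^sup>2 * (t - s)) = (t - s) * ?I - ?N\<^sup>2"
    by blast
  with nonneg show ?thesis by simp
qed (simp add: set_lebesgue_integral_def)

lemma continuous_integral_atMost:
  fixes g :: "real \<Rightarrow> real"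
  assumes "integrable lborel g"
  shows "isCont (\<lambda>x. LINT y:{..x}|lborel. g y) a"
  unfolding continuous_at_sequentially comp_def set_lebesgue_integral_def
proof safe
  fix x :: "nat \<Rightarrow> real"
  assume x: "x \<longlonglongrightarrow> a"
  have [measurable]: "g \<in> borel_measurable borel"
    using borel_measurable_integrable[OF assms] by simp
  show "(\<lambda>n. LINT y|lborel. indicator {..x n} y *\<^sub>R g y) \<longlonglongrightarrow> (LINT y|lborel. indicator {..a} y *\<^sub>R g y)"
  proof (rule integral_dominated_convergence)
    show "integrable lborel (\<lambda>y. norm (g y))" using assms by simp
    \<comment> \<open>At \<open>y = a\<close> the indicators may oscillate, but a single point is a
      null set.\<close>
    have "(\<lambda>n. indicator {..x n} y *\<^sub>R g y) \<longlonglongrightarrow> indicator {..a} y *\<^sub>R g y" if "y \<noteq> a" for y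
    proof (rule tendsto_eventually)
      show "\<forall>\<^sub>F n in sequentially. indicator {..x n} y *\<^sub>R g y = indicator {..a} y *\<^sub>R g y"
      proof (cases "y < a")
        case True
        show ?thesis
          using order_tendstoD(1)[OF x True] by eventually_elim (use True in simp)
      next
        case False
        then have "a < y" using that by simp
        show ?thesis
          using order_tendstoD(2)[OF x \<open>a < y\<close>] by eventually_elim (use \<open>a < y\<close> in simp)
      qed
    qed
    then show "AE y in lborel. (\<lambda>n. indicator {..x n} y *\<^sub>R g y) \<longlonglongrightarrow> indicator {..a} y *\<^sub>R g y"
      using AE_lborel_singleton[of a] by (auto elim!: eventually_mono)
    show "AE y in lborel. norm (indicator {..x n} y *\<^sub>R g y) \<le> norm (g y)" for n
      by (rule AE_I2) (simp add: indicator_def)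
  qed simp_all
qed

lemma has_vector_derivative_0_sandwich:
  fixes f :: "real \<Rightarrow> 'a::real_normed_vector"
  assumes "\<And>t. norm (f t - f a) \<le> \<bar>t - a\<bar> * r t" "(r \<longlongrightarrow> 0) (at a)"
  shows "(f has_vector_derivative 0) (at a)"
  unfolding has_vector_derivative_def
proof (rule has_derivativeI_sandwich[of 1])
  show "norm (f t - f a - (t - a) *\<^sub>R 0) / norm (t - a) \<le> r t" if "t \<noteq> a" for t
    using assms(1)[of t] that by (simp add: divide_simps mult.commute)
qed (use assms(2) in auto)

text \<open>The equation makes \<open>w \<and> d\<close> equal to a \<open>C\<^sup>1\<close> function \<open>P\<close>. To differentiate \<open>w\<close> at \<open>a\<close> without a chain
  rule for weak derivatives, split \<open>w t\<close> along \<open>w a\<close>: the errors in \<open>w a \<and> w t\<close> and \<open>w a \<bullet> w t\<close> are at most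
  \<open>(\<integral>\<bar>d\<bar>)\<^sup>2 \<le> \<bar>t - a\<bar> \<integral>\<bar>d\<bar>\<^sup>2 = o(t - a)\<close>, the integrals being taken between \<open>a\<close> and \<open>t\<close>. Here \<open>d\<close> may be replaced by the
  square integrable weak derivative \<open>d0\<close>, as both have the same integrals over intervals.\<close>

lemma stationary_solution_regular:
  assumes "w \<in> H1" "stationary_solution h0 w"
  obtains P where "\<And>x. (w has_vector_derivative P x \<times> w x) (at x)"
    "\<And>x. (P has_vector_derivative - (w x \<times> lower_field h0 (w x))) (at x)"
    "\<And>x. P x \<bullet> w x = 0"
proof -
  have w: "continuous_on UNIV w" and norm_w: "\<And>x. norm (w x) = 1"
    using assms(1) by (auto simp: H1_def subset_iff)
  obtain d0 where d0: "weak_derivative w d0" "in_L2 d0"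
    using assms(1) by (auto simp: H1_def)
  obtain d where d: "weak_derivative w d" "\<And>\<phi>. test_function \<phi> \<Longrightarrow> cross_H h0 w d \<phi> = 0"
    using assms(2) by (auto simp: stationary_solution_def)
  have ld0: "locally_integrable d0" and ld: "locally_integrable d"
    using d0 d by (auto simp: weak_derivative_def)
  define g where "g x = w x \<times> lower_field h0 (w x)" for x
  have cont_g: "continuous_on UNIV g"
    unfolding g_def lower_field_def by (intro continuous_intros continuous_on_cross w)
  \<comment> \<open>In \<open>cross_H\<close> the term with \<open>d x \<times> d x\<close>
    vanishes, so the equation is exactly the weak form of (w x d)' = - g.\<close>
  have "weak_derivative (\<lambda>x. w x \<times> d x) (\<lambda>x. - g x)"
    unfolding weak_derivative_def
  proof (intro conjI allI impI locally_integrable_cross w ld)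
    show "locally_integrable (\<lambda>x. - g x)"
      by (intro locally_integrable_continuous continuous_intros cont_g)
    fix \<phi> assume "test_function \<phi>"
    from d(2)[OF this] show "(LINT x|lborel. deriv \<phi> x *\<^sub>R (w x \<times> d x)) = - (LINT x|lborel. \<phi> x *\<^sub>R - g x)"
      by (simp add: cross_H_def cross_add_left cross_mult_left g_def)
  qed
  then obtain P where P: "\<And>x. (P has_vector_derivative - g x) (at x)"
    "\<And>a b. a \<le> b \<Longrightarrow> (LINT x:{a<..b}|lborel. w x \<times> d x) = (LINT x:{a<..b}|lborel. P x)"
    by (rule weak_derivative_continuous_imp) (use cont_g in \<open>auto intro: continuous_intros\<close>)
  have cont_P: "continuous_on UNIV P"
    using P(1) by (meson continuous_at_imp_continuous_on has_vector_derivative_continuous)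
  obtain Q where Q: "\<And>x. (Q has_vector_derivative P x) (at x)"
    by (rule ex_antiderivative[OF cont_P]) (rule that)
  have cross_d0: "(LINT x:{a<..b}|lborel. w x \<times> d0 x) = Q b - Q a" if ab: "a \<le> b" for a b
  proof -
    have "(LINT x:{s<..t}|lborel. d x - d0 x) = 0" if "s \<le> t" for s t
      using weak_derivative_increment[OF d(1) w that] weak_derivative_increment[OF d0(1) w that]
      by (simp add: set_integral_diff(2) locally_integrable_Ioc ld ld0)
    then have "(LINT x:{a<..b}|lborel. w x \<times> (d x - d0 x)) = 0"
      using ld ld0 by (intro set_integral_cross_eq_0 w ab) (auto simp: locally_integrable_def)
    moreover have "(LINT x:{a<..b}|lborel. w x \<times> (d x - d0 x))
        = (LINT x:{a<..b}|lborel. w x \<times> d x) - (LINT x:{a<..b}|lborel. w x \<times> d0 x)"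
      by (simp add: bounded_bilinear.diff_right[OF bounded_bilinear_cross] set_integral_diff(2)
          locally_integrable_Ioc locally_integrable_cross w ld ld0)
    ultimately show ?thesis
      using P(2)[OF ab] integral_Ioc_FTC[OF ab Q cont_P] by simp
  qed
  have d0_sq: "integrable lborel (\<lambda>x. (norm (d0 x))\<^sup>2)"
    using d0(2) by (simp add: in_L2_def)
  have ld0_sq: "locally_integrable (\<lambda>x. (norm (d0 x))\<^sup>2)"
    unfolding locally_integrable_def set_integrable_def using integrable_mult_indicator[OF _ d0_sq] by auto
  \<comment> \<open>The accumulated energy of \<open>d0\<close>. Its continuity turns the quadratic
    errors below into o(t - a).\<close>
  define J where "J x = (LINT y:{..x}|lborel. (norm (d0 y))\<^sup>2)" for x
  have J_diff: "(LINT x:{s<..t}|lborel. (norm (d0 x))\<^sup>2) = J t - J s" if "s \<le> t" for s t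
  proof -
    have "{..t} = {..s} \<union> {s<..t}" using that by auto
    then have "J t = J s + (LINT x:{s<..t}|lborel. (norm (d0 x))\<^sup>2)"
      unfolding J_def \<open>{..t} = _\<close>
      by (intro set_integral_Un) (use integrable_mult_indicator[OF _ d0_sq] in \<open>auto simp: set_integrable_def\<close>)
    then show ?thesis by simp
  qed
  define N where "N s t = (LINT x:{s<..t}|lborel. norm (d0 x))" for s t
  have N_sq: "(N s t)\<^sup>2 \<le> (t - s) * (J t - J s)" if "s \<le> t" for s t
    using Cauchy_Schwarz_set_integral_Ioc[OF ld0 ld0_sq that] by (simp add: N_def J_diff that)
  have N_nonneg: "N s t \<ge> 0" for s t
    unfolding N_def set_lebesgue_integral_def by (rule Bochner_Integration.integral_nonneg) simp
  have incr: "norm (w t - w s) \<le> N s t" if "s \<le> t" for s t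
    unfolding N_def weak_derivative_increment[OF d0(1) w that, symmetric]
    by (rule set_integral_norm_le) (auto intro: ld0 locally_integrable_norm)
  \<comment> \<open>Both terms are integrals against \<open>d0\<close>, one with \<open>w\<close>
    frozen at \<open>s\<close> and one with \<open>w x\<close>. The difference is at most the
    oscillation \<open>N s t\<close> of \<open>w\<close> times the integral \<open>N s t\<close> of
    \<open>norm (d0 x)\<close>.\<close>
  have est1: "norm (w s \<times> w t - (Q t - Q s)) \<le> (t - s) * (J t - J s)" if st: "s \<le> t" for s t
  proof -
    have cont: "continuous_on UNIV (\<lambda>x. w s - w x)"
      by (intro continuous_intros w)
    have "w s \<times> w t = w s \<times> (w t - w s)"
      by (simp add: bounded_bilinear.diff_right[OF bounded_bilinear_cross])
    also have "\<dots> = (LINT x:{s<..t}|lborel. w s \<times> d0 x)"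
      by (simp add: set_integral_cross_left ld0 weak_derivative_increment[OF d0(1) w st])
    finally have "w s \<times> w t - (Q t - Q s) = (LINT x:{s<..t}|lborel. (w s - w x) \<times> d0 x)"
      by (simp add: bounded_bilinear.diff_left[OF bounded_bilinear_cross] set_integral_diff(2)
          locally_integrable_Ioc locally_integrable_cross w ld0 cross_d0[OF st])
    also have "norm \<dots> \<le> (LINT x:{s<..t}|lborel. N s t * norm (d0 x))"
    proof (rule set_integral_norm_le)
      show "locally_integrable (\<lambda>x. N s t * norm (d0 x))"
        using locally_integrable_norm[OF ld0] by (auto simp: locally_integrable_def)
      show "norm ((w s - w x) \<times> d0 x) \<le> N s t * norm (d0 x)" if x: "x \<in> {s<..t}" for x
      proof -
        have "N s t = N s x + N x t"
          unfolding N_def by (rule set_integral_Ioc_combine) (use x ld0 in \<open>auto intro: locally_integrable_norm\<close>)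
        then have "norm (w s - w x) \<le> N s t"
          using incr[of s x] x N_nonneg[of x t] by (simp add: norm_minus_commute)
        then show ?thesis
          using norm_cross_le[of "w s - w x" "d0 x"] mult_right_mono[of "norm (w s - w x)" "N s t" "norm (d0 x)"] by simp
      qed
    qed (rule locally_integrable_cross[OF cont ld0])
    also have "\<dots> = (N s t)\<^sup>2"
      by (simp add: N_def power2_eq_square)
    finally show ?thesis using N_sq[OF st] by simp
  qed
  have est2: "(norm (w t - w s))\<^sup>2 \<le> (t - s) * (J t - J s)" if "s \<le> t" for s t
    using power_mono[OF incr[OF that], of 2] N_sq[OF that] by simp
  have J_mono: "J s \<le> J t" if "s \<le> t" for s t
    using J_diff[OF that] Bochner_Integration.integral_nonneg[of lborel "\<lambda>x. indicator {s<..t} x *\<^sub>R (norm (d0 x))\<^sup>2"]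
    by (simp add: set_lebesgue_integral_def)
  have sandwich: "((\<lambda>t. \<bar>J t - J a\<bar>) \<longlongrightarrow> 0) (at a)" for a
  proof -
    have "isCont J a"
      unfolding J_def[abs_def] by (rule continuous_integral_atMost[OF d0_sq])
    then have "((\<lambda>t. J t - J a) \<longlongrightarrow> J a - J a) (at a)"
      by (intro tendsto_intros) (simp add: isCont_def)
    then show ?thesis
      by (simp add: tendsto_rabs_zero_iff)
  qed
  have abs_est1: "norm (w a \<times> w t - (Q t - Q a)) \<le> \<bar>t - a\<bar> * \<bar>J t - J a\<bar>" for a t
  proof (cases "a \<le> t")
    case True
    then show ?thesis using est1[OF True] J_mono[OF True] by simp
  next
    case False
    have "w a \<times> w t - (Q t - Q a) = - (w t \<times> w a - (Q a - Q t))"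
      by (simp add: cross_skew[of "w a" "w t"])
    then have "norm (w a \<times> w t - (Q t - Q a)) = norm (w t \<times> w a - (Q a - Q t))"
      by (simp only: norm_minus_cancel)
    then show ?thesis using est1[of t a] J_mono[of t a] False by simp
  qed
  have abs_est2: "(norm (w t - w a))\<^sup>2 \<le> \<bar>t - a\<bar> * \<bar>J t - J a\<bar>" for a t
    using est2[of a t] est2[of t a] J_mono[of a t] J_mono[of t a]
    by (cases "a \<le> t") (simp_all add: norm_minus_commute)
  have cross_deriv: "((\<lambda>t. w a \<times> w t) has_vector_derivative P a) (at a)" for a
  proof -
    have "((\<lambda>t. w a \<times> w t - (Q t - Q a)) has_vector_derivative 0) (at a)"
      by (rule has_vector_derivative_0_sandwich[OF _ sandwich]) (use abs_est1 in simp)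
    then have "((\<lambda>t. (w a \<times> w t - (Q t - Q a)) + (Q t - Q a)) has_vector_derivative 0 + (P a - 0)) (at a)"
      by (intro has_vector_derivative_add has_vector_derivative_diff Q has_vector_derivative_const)
    then show ?thesis by simp
  qed
  have inner_deriv: "((\<lambda>t. w a \<bullet> w t) has_real_derivative 0) (at a)" for a
  proof -
    \<comment> \<open>For unit vectors the inner product differs from 1 only to second order in the
      distance, so it has derivative 0 at \<open>a\<close>.\<close>
    have eq: "w a \<bullet> w t - w a \<bullet> w a = - ((norm (w t - w a))\<^sup>2 / 2)" for t
      using norm_w[of a] norm_w[of t] unfolding norm_eq_1
      by (simp add: power2_norm_eq_inner inner_diff inner_commute diff_divide_distrib)
    show ?thesis
      unfolding has_real_derivative_iff_has_vector_derivative
    proof (rule has_vector_derivative_0_sandwich[OF _ sandwich])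
      show "norm (w a \<bullet> w t - w a \<bullet> w a) \<le> \<bar>t - a\<bar> * \<bar>J t - J a\<bar>" for t
        using abs_est2[of t a] zero_le_power2[of "norm (w t - w a)"] unfolding eq real_norm_def by linarith
    qed
  qed
  have Pw: "P a \<bullet> w a = 0" for a
  proof -
    \<comment> \<open>\<open>P a\<close> is the derivative of \<open>w a \<times> w t\<close>, which
      stays orthogonal to \<open>w a\<close>.\<close>
    have "((\<lambda>t. (w a \<times> w t) \<bullet> w a) has_vector_derivative P a \<bullet> w a) (at a)"
      by (rule bounded_linear.has_vector_derivative[OF bounded_linear_inner_left cross_deriv])
    then have "((\<lambda>t. 0 :: real) has_vector_derivative P a \<bullet> w a) (at a)"
      by (simp add: dot_cross_self)
    then show ?thesis
      using vector_derivative_unique_at[OF _ has_vector_derivative_const] by blast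
  qed
  have "(w has_vector_derivative P a \<times> w a) (at a)" for a
  proof -
    \<comment> \<open>Splitting along the unit vector \<open>w a\<close>, with the orthogonal part
      written as a double cross product: both pieces are differentiable at
      \<open>t = a\<close>.\<close>
    have eq: "w t = (w a \<times> w t) \<times> w a + (w a \<bullet> w t) *\<^sub>R w a" for t
    proof -
      have "(w a \<times> w t) \<times> w a = (w a \<bullet> w a) *\<^sub>R w t - (w a \<bullet> w t) *\<^sub>R w a"
        by (simp add: vec_eq_iff forall_3 cross_components inner_vec_def sum_3 algebra_simps)
      then show ?thesis
        using norm_w[of a] by (simp add: norm_eq_1)
    qed
    have "((\<lambda>t. (w a \<times> w t) \<times> w a + (w a \<bullet> w t) *\<^sub>R w a) has_vector_derivative
        P a \<times> w a + (w a \<bullet> w a) *\<^sub>R 0 + 0 *\<^sub>R w a) (at a)"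
      using has_vector_derivative_add[OF
          bounded_linear.has_vector_derivative[OF bounded_bilinear.bounded_linear_left[OF bounded_bilinear_cross] cross_deriv]
          has_vector_derivative_scaleR[OF inner_deriv has_vector_derivative_const]]
      by simp
    then show ?thesis
      by (simp flip: eq)
  qed
  then show ?thesis
    using that[of P] P(1) Pw by (simp add: g_def)
qed

section \<open>Stationary profiles\<close>

lemma tendsto_derivative_at_bot:
  fixes f :: "real \<Rightarrow> real"
  assumes f: "\<And>x. (f has_real_derivative g x) (at x)" and g: "\<And>x. (g has_real_derivative k x) (at x)"
    and f0: "(f \<longlongrightarrow> 0) at_bot" and k0: "(k \<longlongrightarrow> 0) at_bot"
  shows "(g \<longlongrightarrow> 0) at_bot"
proof (rule tendstoI)
  fix e :: real assume "e > 0"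
  then have e: "e / 4 > 0" by simp
  from tendstoD[OF f0 e] tendstoD[OF k0 e]
  have "\<forall>\<^sub>F x in at_bot. \<bar>f x\<bar> < e / 4 \<and> \<bar>k x\<bar> < e / 4"
    by eventually_elim (simp add: dist_real_def)
  then obtain N where N: "\<And>x. x \<le> N \<Longrightarrow> \<bar>f x\<bar> < e / 4" "\<And>x. x \<le> N \<Longrightarrow> \<bar>k x\<bar> < e / 4"
    by (auto simp: eventually_at_bot_linorder)
  have "dist (g x) 0 < e" if x: "x \<le> N" for x
  proof -
    obtain y where y: "x - 1 < y" "y < x" "f x - f (x - 1) = g y"
      using MVT2[of "x - 1" x f g] f by auto
    obtain z where z: "y < z" "z < x" "g x - g y = (x - y) * k z"
      using MVT2[of y x g k] y g by auto
    have "\<bar>(x - y) * k z\<bar> \<le> 1 * \<bar>k z\<bar>"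
      unfolding abs_mult by (rule mult_right_mono) (use y in auto)
    moreover have "\<bar>f x\<bar> < e / 4" "\<bar>f (x - 1)\<bar> < e / 4" "\<bar>k z\<bar> < e / 4"
      using N x z by auto
    ultimately show ?thesis
      using y(3) z(3) by (simp add: dist_real_def)
  qed
  then show "\<forall>\<^sub>F x in at_bot. dist (g x) 0 < e"
    by (auto simp: eventually_at_bot_linorder)
qed

text \<open>\<open>D x * exp (- C * x)\<close> is nonincreasing, which carries the zero to the
  right; \<open>D x * exp (C * x)\<close> is nondecreasing, which carries it to the left.\<close>

lemma Gronwall_zero:
  fixes D D' :: "real \<Rightarrow> real"
  assumes D: "\<And>x. (D has_real_derivative D' x) (at x)" and le: "\<And>x. \<bar>D' x\<bar> \<le> C * D x"
    and nonneg: "\<And>x. D x \<ge> 0" and zero: "D a = 0"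
  shows "D x = 0"
proof (cases "a \<le> x")
  case True
  have "D x * exp (- C * x) \<le> D a * exp (- C * a)"
  proof (rule DERIV_nonpos_imp_nonincreasing[OF True])
    fix y
    have "((\<lambda>x. D x * exp (- C * x)) has_real_derivative (D' y - C * D y) * exp (- C * y)) (at y)"
      by (auto intro!: derivative_eq_intros D simp: algebra_simps)
    moreover have "(D' y - C * D y) * exp (- C * y) \<le> 0"
      using le[of y] by (intro mult_nonpos_nonneg) auto
    ultimately show "\<exists>z. ((\<lambda>x. D x * exp (- C * x)) has_real_derivative z) (at y) \<and> z \<le> 0" by blast
  qed
  then show ?thesis using nonneg[of x] by (simp add: zero mult_le_0_iff)
next
  case False
  then have "x \<le> a" by simp
  have "D x * exp (C * x) \<le> D a * exp (C * a)"
  proof (rule DERIV_nonneg_imp_nondecreasing[OF \<open>x \<le> a\<close>])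
    fix y
    have "((\<lambda>x. D x * exp (C * x)) has_real_derivative (D' y + C * D y) * exp (C * y)) (at y)"
      by (auto intro!: derivative_eq_intros D simp: algebra_simps)
    moreover have "0 \<le> (D' y + C * D y) * exp (C * y)"
      using le[of y] by (intro mult_nonneg_nonneg) auto
    ultimately show "\<exists>z. ((\<lambda>x. D x * exp (C * x)) has_real_derivative z) (at y) \<and> 0 \<le> z" by blast
  qed
  then show ?thesis using nonneg[of x] by (simp add: zero mult_le_0_iff)
qed

text \<open>The combinations \<open>k * f x + g x\<close> and \<open>k * f x - g x\<close> decouple
  the system: each is a pure exponential.\<close>

lemma hyperbolic_ode:
  fixes f g :: "real \<Rightarrow> real"
  assumes f: "\<And>x. (f has_real_derivative g x) (at x)"
    and g: "\<And>x. (g has_real_derivative k\<^sup>2 * f x) (at x)" and k: "k \<noteq> 0"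
  obtains a b where "\<And>x. f x = a * exp (k * x) + b * exp (- (k * x))"
    "\<And>x. g x = k * (a * exp (k * x) - b * exp (- (k * x)))"
proof -
  have "((\<lambda>x. (k * f x + g x) * exp (- (k * x))) has_real_derivative 0) (at x)"
    and "((\<lambda>x. (k * f x - g x) * exp (k * x)) has_real_derivative 0) (at x)" for x
    by (auto intro!: derivative_eq_intros f g simp: algebra_simps power2_eq_square)
  then have c: "(k * f x + g x) * exp (- (k * x)) = k * f 0 + g 0"
    "(k * f x - g x) * exp (k * x) = k * f 0 - g 0" for x
    using DERIV_isconst_all[of "\<lambda>x. (k * f x + g x) * exp (- (k * x))" x 0]
      DERIV_isconst_all[of "\<lambda>x. (k * f x - g x) * exp (k * x)" x 0] by auto
  define A B where "A = k * f 0 + g 0" and "B = k * f 0 - g 0"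
  have *: "k * f x + g x = A * exp (k * x)" "k * f x - g x = B * exp (- (k * x))" for x
    using c[of x, symmetric] by (simp_all add: A_def B_def flip: exp_add)
  show ?thesis
  proof (rule that[of "A / (2 * k)" "B / (2 * k)"])
    show "f x = A / (2 * k) * exp (k * x) + B / (2 * k) * exp (- (k * x))" for x
    proof -
      have "f x = ((k * f x + g x) + (k * f x - g x)) / (2 * k)" using k by simp
      then show ?thesis unfolding * by (simp add: add_divide_distrib)
    qed
    show "g x = k * (A / (2 * k) * exp (k * x) - B / (2 * k) * exp (- (k * x)))" for x
    proof -
      have "g x = ((k * f x + g x) - (k * f x - g x)) / 2" by simp
      then show ?thesis unfolding * using k by (simp add: diff_divide_distrib right_diff_distrib)
    qed
  qed
qed

text \<open>For the profile \<open>(cos \<theta>, sin \<theta>, 0)\<close> this is \<open>cot (\<theta> / 2)\<close>, its stereographic projection from \<open>e\<^sub>1\<close>.\<close>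

definition zeta :: "real \<Rightarrow> real \<Rightarrow> real" where
  "zeta h0 x = exp (- (sqrt (1 + h0) * x)) - h0 / (4 * (1 + h0)) * exp (sqrt (1 + h0) * x)"

text \<open>The \<open>u\<^sub>i\<close> are the coordinates of \<open>w\<close>, the \<open>p\<^sub>i\<close> those of \<open>w \<and> w'\<close>.\<close>

locale stationary_profile =
  fixes h0 :: real and u1 u2 u3 p1 p2 p3 :: "real \<Rightarrow> real"
  assumes u1: "\<And>x. (u1 has_real_derivative p2 x * u3 x - p3 x * u2 x) (at x)"
    and u2: "\<And>x. (u2 has_real_derivative p3 x * u1 x - p1 x * u3 x) (at x)"
    and u3: "\<And>x. (u3 has_real_derivative p1 x * u2 x - p2 x * u1 x) (at x)"
    and p1: "\<And>x. (p1 has_real_derivative 0) (at x)"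
    and p2: "\<And>x. (p2 has_real_derivative - (u3 x * (h0 + u1 x))) (at x)"
    and p3: "\<And>x. (p3 has_real_derivative u2 x * (h0 + u1 x)) (at x)"
    and unit: "\<And>x. (u1 x)\<^sup>2 + (u2 x)\<^sup>2 + (u3 x)\<^sup>2 = 1"
    and orth: "\<And>x. p1 x * u1 x + p2 x * u2 x + p3 x * u3 x = 0"
    and lim: "(u1 \<longlongrightarrow> 1) at_bot"
begin

section \<open>Conserved quantities and limits at minus infinity\<close>

lemma abs_u1_le: "\<bar>u1 x\<bar> \<le> 1"
proof -
  have "(u1 x)\<^sup>2 \<le> 1"
    using unit[of x] zero_le_power2[of "u2 x"] zero_le_power2[of "u3 x"] by linarith
  then show ?thesis by (simp add: abs_square_le_1)
qed

lemma u_lims: "(u2 \<longlongrightarrow> 0) at_bot" "(u3 \<longlongrightarrow> 0) at_bot"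
proof -
  have "((\<lambda>x. sqrt (1 - (u1 x)\<^sup>2)) \<longlongrightarrow> sqrt (1 - 1\<^sup>2)) at_bot"
    by (intro tendsto_intros lim)
  then have s: "((\<lambda>x. sqrt (1 - (u1 x)\<^sup>2)) \<longlongrightarrow> 0) at_bot" by simp
  have sq: "(u2 x)\<^sup>2 \<le> 1 - (u1 x)\<^sup>2" "(u3 x)\<^sup>2 \<le> 1 - (u1 x)\<^sup>2" for x
    using unit[of x] zero_le_power2[of "u2 x"] zero_le_power2[of "u3 x"] by linarith+
  have le: "norm (u2 x) \<le> sqrt (1 - (u1 x)\<^sup>2)" "norm (u3 x) \<le> sqrt (1 - (u1 x)\<^sup>2)" for x
    using sq by (auto intro!: real_le_rsqrt)
  show "(u2 \<longlongrightarrow> 0) at_bot" "(u3 \<longlongrightarrow> 0) at_bot"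
    by (rule Lim_null_comparison[OF _ s]; use le in auto)+
qed

text \<open>The equations give p2 p2' + p3 p3' = - (h0 + u1) u1', and the right-hand side is minus
  half the derivative of u1^2 + 2 h0 u1.\<close>

lemma energy: "(p1 x)\<^sup>2 + (p2 x)\<^sup>2 + (p3 x)\<^sup>2 + (u1 x)\<^sup>2 + 2 * h0 * u1 x
    = (p1 0)\<^sup>2 + (p2 0)\<^sup>2 + (p3 0)\<^sup>2 + (u1 0)\<^sup>2 + 2 * h0 * u1 0"
proof -
  have "((\<lambda>x. (p1 x)\<^sup>2 + (p2 x)\<^sup>2 + (p3 x)\<^sup>2 + (u1 x)\<^sup>2 + 2 * h0 * u1 x) has_real_derivative 0) (at x)" for x
    by (auto intro!: derivative_eq_intros u1 p1 p2 p3 simp: algebra_simps power2_eq_square)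
  then show ?thesis
    using DERIV_isconst_all[of "\<lambda>x. (p1 x)\<^sup>2 + (p2 x)\<^sup>2 + (p3 x)\<^sup>2 + (u1 x)\<^sup>2 + 2 * h0 * u1 x" x 0] by blast
qed

text \<open>Conservation of energy bounds the momenta because \<open>u1\<close> is bounded. Only
  boundedness is available at this stage; it makes products with null functions tend to 0, from
  which the limits of \<open>p2\<close> and \<open>p3\<close> are derived later.\<close>

lemma p_bounded: obtains B where "\<And>x. \<bar>p2 x\<bar> \<le> B" "\<And>x. \<bar>p3 x\<bar> \<le> B"
proof -
  define K where "K = (p1 0)\<^sup>2 + (p2 0)\<^sup>2 + (p3 0)\<^sup>2 + (u1 0)\<^sup>2 + 2 * h0 * u1 0 + 2 * \<bar>h0\<bar>"
  have "(p1 x)\<^sup>2 + (p2 x)\<^sup>2 + (p3 x)\<^sup>2 \<le> K" for x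
  proof -
    have "\<bar>h0 * u1 x\<bar> \<le> \<bar>h0\<bar> * 1"
      unfolding abs_mult by (rule mult_left_mono) (use abs_u1_le in auto)
    then show ?thesis
      using energy[of x] zero_le_power2[of "u1 x"] unfolding K_def by linarith
  qed
  then have "(p2 x)\<^sup>2 \<le> K" "(p3 x)\<^sup>2 \<le> K" for x
    using zero_le_power2[of "p1 x"] zero_le_power2[of "p2 x"] zero_le_power2[of "p3 x"]
    by (meson add_increasing add_increasing2 order_trans order_refl add_nonneg_nonneg)+
  then show ?thesis
    using that[of "sqrt K"] real_le_rsqrt by (metis power2_abs)
qed

lemma p_mult_tendsto_0:
  assumes "(f \<longlongrightarrow> 0) at_bot"
  shows "((\<lambda>x. p2 x * f x) \<longlongrightarrow> 0) at_bot" "((\<lambda>x. p3 x * f x) \<longlongrightarrow> 0) at_bot"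
proof -
  obtain B where B: "\<And>x. \<bar>p2 x\<bar> \<le> B" "\<And>x. \<bar>p3 x\<bar> \<le> B" by (rule p_bounded) (rule that)
  have lim0: "((\<lambda>x. B * norm (f x)) \<longlongrightarrow> 0) at_bot"
    using tendsto_mult_right_zero tendsto_norm_zero[OF assms] by blast
  show "((\<lambda>x. p2 x * f x) \<longlongrightarrow> 0) at_bot" "((\<lambda>x. p3 x * f x) \<longlongrightarrow> 0) at_bot"
    by (intro Lim_null_comparison[OF always_eventually lim0] allI; simp add: abs_mult mult_right_mono B)+
qed

text \<open>By orthogonality p1 u1 = - (p2 u2 + p3 u3), which tends to 0, while \<open>p1\<close> is
  constant and \<open>u1\<close> tends to 1.\<close>

lemma p1_eq_0: "p1 x = 0"
proof -
  have const: "p1 y = p1 x" for y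
    using DERIV_isconst_all p1 by blast
  have "((\<lambda>y. - (p2 y * u2 y + p3 y * u3 y)) \<longlongrightarrow> - (0 + 0)) at_bot"
    by (intro tendsto_intros p_mult_tendsto_0 u_lims)
  moreover have "- (p2 y * u2 y + p3 y * u3 y) = p1 x * u1 y" for y
    using orth[of y] const[of y] by simp
  ultimately have "((\<lambda>y. p1 x * u1 y) \<longlongrightarrow> 0) at_bot" by simp
  moreover have "((\<lambda>y. p1 x * u1 y) \<longlongrightarrow> p1 x * 1) at_bot"
    by (intro tendsto_intros lim)
  ultimately show ?thesis
    using tendsto_unique[OF trivial_limit_at_bot_linorder] by fastforce
qed

text \<open>Since \<open>p1\<close> vanishes, u2' = p3 u1 and u3' = - p2 u1. Here \<open>u2\<close>,
  \<open>u3\<close> and their second derivatives tend to 0, hence so do the first derivatives, and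
  dividing by \<open>u1\<close>, which tends to 1, leaves the momenta.\<close>

lemma p_lims: "(p2 \<longlongrightarrow> 0) at_bot" "(p3 \<longlongrightarrow> 0) at_bot"
proof -
  have u1': "((\<lambda>x. p2 x * u3 x - p3 x * u2 x) \<longlongrightarrow> 0 - 0) at_bot"
    by (intro tendsto_diff p_mult_tendsto_0 u_lims)
  have 3: "((\<lambda>x. p3 x * u1 x) \<longlongrightarrow> 0) at_bot"
  proof (rule tendsto_derivative_at_bot)
    show "(u2 has_real_derivative p3 x * u1 x) (at x)" for x
      using u2[of x] by (simp add: p1_eq_0)
    show "((\<lambda>x. p3 x * u1 x) has_real_derivative u2 x * (h0 + u1 x) * u1 x + p3 x * (p2 x * u3 x - p3 x * u2 x)) (at x)" for x
      by (auto intro!: derivative_eq_intros p3 u1)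
    have "((\<lambda>x. u2 x * (h0 + u1 x) * u1 x + p3 x * (p2 x * u3 x - p3 x * u2 x)) \<longlongrightarrow> 0 * (h0 + 1) * 1 + 0) at_bot"
      using u1' by (intro tendsto_intros u_lims lim p_mult_tendsto_0) simp
    then show "((\<lambda>x. u2 x * (h0 + u1 x) * u1 x + p3 x * (p2 x * u3 x - p3 x * u2 x)) \<longlongrightarrow> 0) at_bot" by simp
  qed (rule u_lims)
  have 2: "((\<lambda>x. - (p2 x * u1 x)) \<longlongrightarrow> 0) at_bot"
  proof (rule tendsto_derivative_at_bot)
    show "(u3 has_real_derivative - (p2 x * u1 x)) (at x)" for x
      using u3[of x] by (simp add: p1_eq_0)
    show "((\<lambda>x. - (p2 x * u1 x)) has_real_derivative u3 x * (h0 + u1 x) * u1 x - p2 x * (p2 x * u3 x - p3 x * u2 x)) (at x)" for x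
      by (auto intro!: derivative_eq_intros p2 u1)
    have "((\<lambda>x. u3 x * (h0 + u1 x) * u1 x - p2 x * (p2 x * u3 x - p3 x * u2 x)) \<longlongrightarrow> 0 * (h0 + 1) * 1 - 0) at_bot"
      using u1' by (intro tendsto_intros u_lims lim p_mult_tendsto_0) simp
    then show "((\<lambda>x. u3 x * (h0 + u1 x) * u1 x - p2 x * (p2 x * u3 x - p3 x * u2 x)) \<longlongrightarrow> 0) at_bot" by simp
  qed (rule u_lims)
  have pos: "\<forall>\<^sub>F x in at_bot. u1 x \<noteq> 0"
    using order_tendstoD(1)[OF lim zero_less_one] by eventually_elim simp
  have "((\<lambda>x. - (- (p2 x * u1 x)) / u1 x) \<longlongrightarrow> - 0 / 1) at_bot"
    by (intro tendsto_intros 2 lim) simp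
  then have "((\<lambda>x. - (- (p2 x * u1 x)) / u1 x) \<longlongrightarrow> 0) at_bot" by simp
  then show "(p2 \<longlongrightarrow> 0) at_bot"
    by (rule Lim_transform_eventually) (use pos in \<open>auto elim!: eventually_mono\<close>)
  have "((\<lambda>x. p3 x * u1 x / u1 x) \<longlongrightarrow> 0 / 1) at_bot"
    by (intro tendsto_intros 3 lim) simp
  then have "((\<lambda>x. p3 x * u1 x / u1 x) \<longlongrightarrow> 0) at_bot" by simp
  then show "(p3 \<longlongrightarrow> 0) at_bot"
    by (rule Lim_transform_eventually) (use pos in \<open>auto elim!: eventually_mono\<close>)
qed

text \<open>At minus infinity the conserved energy takes the value 1 + 2 h0.\<close>

lemma p_sq: "(p2 x)\<^sup>2 + (p3 x)\<^sup>2 = (1 - u1 x) * (1 + u1 x + 2 * h0)"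
proof -
  have "((\<lambda>y. (p1 y)\<^sup>2 + (p2 y)\<^sup>2 + (p3 y)\<^sup>2 + (u1 y)\<^sup>2 + 2 * h0 * u1 y) \<longlongrightarrow> 0\<^sup>2 + 0\<^sup>2 + 0\<^sup>2 + 1\<^sup>2 + 2 * h0 * 1) at_bot"
    unfolding p1_eq_0 by (intro tendsto_intros p_lims lim)
  moreover have "(p1 y)\<^sup>2 + (p2 y)\<^sup>2 + (p3 y)\<^sup>2 + (u1 y)\<^sup>2 + 2 * h0 * u1 y
      = (p1 x)\<^sup>2 + (p2 x)\<^sup>2 + (p3 x)\<^sup>2 + (u1 x)\<^sup>2 + 2 * h0 * u1 x" for y
    using energy[of y] energy[of x] by simp
  then have "((\<lambda>y. (p1 y)\<^sup>2 + (p2 y)\<^sup>2 + (p3 y)\<^sup>2 + (u1 y)\<^sup>2 + 2 * h0 * u1 y)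
      \<longlongrightarrow> (p1 x)\<^sup>2 + (p2 x)\<^sup>2 + (p3 x)\<^sup>2 + (u1 x)\<^sup>2 + 2 * h0 * u1 x) at_bot"
    by (intro tendsto_eventually always_eventually) blast
  ultimately have "(p1 x)\<^sup>2 + (p2 x)\<^sup>2 + (p3 x)\<^sup>2 + (u1 x)\<^sup>2 + 2 * h0 * u1 x = 1 + 2 * h0"
    using tendsto_unique[OF trivial_limit_at_bot_linorder] by fastforce
  then show ?thesis
    by (simp add: p1_eq_0 algebra_simps power2_eq_square)
qed

text \<open>The square of u1' is at most the product of \<open>p2\<^sup>2 + p3\<^sup>2\<close> and
  \<open>u2\<^sup>2 + u3\<^sup>2\<close>, and each factor contains \<open>1 - u1\<close>, by
  \<open>p_sq\<close> and by the unit length respectively. So \<open>1 - u1\<close> satisfies a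
  linear differential inequality, and one zero spreads to the whole line.\<close>

lemma u1_eq_1_or: "(\<forall>x. u1 x = 1) \<or> (\<forall>x. u1 x < 1)"
proof (rule ccontr)
  assume "\<not> ?thesis"
  then obtain a b where ab: "u1 a \<noteq> 1" "u1 b = 1"
    using abs_u1_le by (metis abs_le_D1 less_eq_real_def)
  \<comment> \<open>Dominates both remaining factors, \<open>1 + u1 x + 2 * h0\<close> and
    \<open>1 + u1 x\<close>.\<close>
  define C where "C = 2 + 2 * \<bar>h0\<bar>"
  have "1 - u1 a = 0"
  proof (rule Gronwall_zero[where D = "\<lambda>x. 1 - u1 x" and a = b and C = C])
    show "((\<lambda>x. 1 - u1 x) has_real_derivative p3 x * u2 x - p2 x * u3 x) (at x)" for x
      by (auto intro!: derivative_eq_intros u1)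
    show "0 \<le> 1 - u1 x" for x using abs_u1_le[of x] by simp
    show "1 - u1 b = 0" using ab by simp
    show "\<bar>p3 x * u2 x - p2 x * u3 x\<bar> \<le> C * (1 - u1 x)" for x
    proof (rule abs_le_square_iff[THEN iffD2, THEN order_trans])
      \<comment> \<open>Lagrange's identity; the discarded square is that of p2 u2 + p3 u3.\<close>
      have "(p3 x * u2 x - p2 x * u3 x)\<^sup>2 \<le> ((p2 x)\<^sup>2 + (p3 x)\<^sup>2) * ((u2 x)\<^sup>2 + (u3 x)\<^sup>2)"
        using zero_le_power2[of "p3 x * u3 x + p2 x * u2 x"] by (simp add: algebra_simps power2_eq_square)
      also have "(u2 x)\<^sup>2 + (u3 x)\<^sup>2 = (1 - u1 x) * (1 + u1 x)"
        using unit[of x] by (simp add: algebra_simps power2_eq_square)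
      also have "((p2 x)\<^sup>2 + (p3 x)\<^sup>2) * ((1 - u1 x) * (1 + u1 x)) = (1 - u1 x)\<^sup>2 * ((1 + u1 x + 2 * h0) * (1 + u1 x))"
        unfolding p_sq by (simp add: power2_eq_square)
      also have "\<dots> \<le> (1 - u1 x)\<^sup>2 * (C * C)"
      proof (rule mult_left_mono)
        have u: "0 \<le> 1 + u1 x" "1 + u1 x \<le> 2" using abs_u1_le[of x] by auto
        have "(1 + u1 x + 2 * h0) * (1 + u1 x) \<le> C * (1 + u1 x)"
          using u by (intro mult_right_mono) (auto simp: C_def)
        also have "\<dots> \<le> C * C"
          using u by (intro mult_left_mono) (auto simp: C_def)
        finally show "(1 + u1 x + 2 * h0) * (1 + u1 x) \<le> C * C" .
      qed simp
      finally show "(p3 x * u2 x - p2 x * u3 x)\<^sup>2 \<le> (C * (1 - u1 x))\<^sup>2"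
        by (simp add: power2_eq_square algebra_simps)
      show "\<bar>C * (1 - u1 x)\<bar> \<le> C * (1 - u1 x)"
        using abs_u1_le[of x] by (simp add: C_def abs_mult)
    qed
  qed
  with ab show False by simp
qed

lemma h0_gt_if_nonconstant:
  assumes "u1 x < 1"
  shows "h0 > -1"
proof (rule ccontr)
  assume "\<not> h0 > -1"
  then have "1 + u1 x + 2 * h0 < 0" using assms by simp
  then have "(1 - u1 x) * (1 + u1 x + 2 * h0) < 0"
    using assms by (simp add: mult_pos_neg)
  then show False
    using p_sq[of x] by (metis not_sum_power2_lt_zero)
qed

text \<open>The stereographic projection \<open>z\<close> of \<open>w\<close> from \<open>e\<^sub>1\<close> satisfies the linear equation \<open>z'' = (1 + h\<^sub>0) z\<close>.\<close>

lemma stereographic: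
  assumes lt: "\<And>x. u1 x < 1"
  obtains y \<phi> where "\<And>x. u2 x / (1 - u1 x) = cos \<phi> * zeta h0 (x - y)"
    "\<And>x. u3 x / (1 - u1 x) = sin \<phi> * zeta h0 (x - y)"
proof -
  define z2 z3 where "z2 x = u2 x / (1 - u1 x)" and "z3 x = u3 x / (1 - u1 x)" for x
  define k where "k = sqrt (1 + h0)"
  have h0: "h0 > -1" using h0_gt_if_nonconstant lt by blast
  then have k: "k > 0" "k\<^sup>2 = 1 + h0" by (simp_all add: k_def)
  have D: "1 - u1 x \<noteq> 0" for x using lt[of x] by simp
  have orth': "p2 x * u2 x + p3 x * u3 x = 0" for x
    using orth[of x] by (simp add: p1_eq_0)
  \<comment> \<open>Unit length and orthogonality reduce the numerator of the quotient rule to a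
    multiple of \<open>1 - u1 x\<close>, so the derivative of the projection is the momentum, turned
    by a right angle, over \<open>1 - u1 x\<close>.\<close>
  have z2: "(z2 has_real_derivative - (p3 x / (1 - u1 x))) (at x)" for x
  proof -
    have "(z2 has_real_derivative ((p3 x * u1 x - p1 x * u3 x) * (1 - u1 x) - u2 x * (0 - (p2 x * u3 x - p3 x * u2 x)))
        / ((1 - u1 x) * (1 - u1 x))) (at x)"
      unfolding z2_def by (intro DERIV_divide DERIV_diff DERIV_const u1 u2 D)
    moreover have "(p3 x * u1 x - p1 x * u3 x) * (1 - u1 x) - u2 x * (0 - (p2 x * u3 x - p3 x * u2 x)) = - p3 x * (1 - u1 x)"
      unfolding p1_eq_0 using unit[of x] orth'[of x] by algebra
    ultimately show ?thesis using D[of x] by simp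
  qed
  have z3: "(z3 has_real_derivative p2 x / (1 - u1 x)) (at x)" for x
  proof -
    have "(z3 has_real_derivative ((p1 x * u2 x - p2 x * u1 x) * (1 - u1 x) - u3 x * (0 - (p2 x * u3 x - p3 x * u2 x)))
        / ((1 - u1 x) * (1 - u1 x))) (at x)"
      unfolding z3_def by (intro DERIV_divide DERIV_diff DERIV_const u1 u3 D)
    moreover have "(p1 x * u2 x - p2 x * u1 x) * (1 - u1 x) - u3 x * (0 - (p2 x * u3 x - p3 x * u2 x)) = p2 x * (1 - u1 x)"
      unfolding p1_eq_0 using unit[of x] orth'[of x] by algebra
    ultimately show ?thesis using D[of x] by simp
  qed
  \<comment> \<open>Here \<open>p_sq\<close> enters: the quadratic terms in the momenta combine with
    the field term, and the only coefficient left is the constant 1 + h0.\<close>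
  have z2': "((\<lambda>x. - (p3 x / (1 - u1 x))) has_real_derivative k\<^sup>2 * z2 x) (at x)" for x
  proof -
    have "((\<lambda>x. - (p3 x / (1 - u1 x))) has_real_derivative
        - ((u2 x * (h0 + u1 x) * (1 - u1 x) - p3 x * (0 - (p2 x * u3 x - p3 x * u2 x))) / ((1 - u1 x) * (1 - u1 x)))) (at x)"
      by (intro DERIV_minus DERIV_divide DERIV_diff DERIV_const u1 p3 D)
    moreover have "u2 x * (h0 + u1 x) * (1 - u1 x) - p3 x * (0 - (p2 x * u3 x - p3 x * u2 x))
        = - ((1 + h0) * u2 x * (1 - u1 x))"
      using p_sq[of x] orth'[of x] by algebra
    ultimately show ?thesis using D[of x] by (simp add: z2_def k)
  qed
  have z3': "((\<lambda>x. p2 x / (1 - u1 x)) has_real_derivative k\<^sup>2 * z3 x) (at x)" for x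
  proof -
    have "((\<lambda>x. p2 x / (1 - u1 x)) has_real_derivative
        (- (u3 x * (h0 + u1 x)) * (1 - u1 x) - p2 x * (0 - (p2 x * u3 x - p3 x * u2 x))) / ((1 - u1 x) * (1 - u1 x))) (at x)"
      by (intro DERIV_divide DERIV_diff DERIV_const u1 p2 D)
    moreover have "- (u3 x * (h0 + u1 x)) * (1 - u1 x) - p2 x * (0 - (p2 x * u3 x - p3 x * u2 x))
        = (1 + h0) * u3 x * (1 - u1 x)"
      using p_sq[of x] orth'[of x] by algebra
    ultimately show ?thesis using D[of x] by (simp add: z3_def k)
  qed
  obtain a2 b2 where ab2: "\<And>x. z2 x = a2 * exp (k * x) + b2 * exp (- (k * x))"
    "\<And>x. - (p3 x / (1 - u1 x)) = k * (a2 * exp (k * x) - b2 * exp (- (k * x)))"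
    by (rule hyperbolic_ode[OF z2 z2']) (use k in auto)
  obtain a3 b3 where ab3: "\<And>x. z3 x = a3 * exp (k * x) + b3 * exp (- (k * x))"
    "\<And>x. p2 x / (1 - u1 x) = k * (a3 * exp (k * x) - b3 * exp (- (k * x)))"
    by (rule hyperbolic_ode[OF z3 z3']) (use k in auto)
  have z_sq: "((z2 x)\<^sup>2 + (z3 x)\<^sup>2) * (1 - u1 x) = 1 + u1 x" for x
  proof -
    have "((z2 x)\<^sup>2 + (z3 x)\<^sup>2) * (1 - u1 x)\<^sup>2 = (1 + u1 x) * (1 - u1 x)"
      using unit[of x] D[of x] by (simp add: z2_def z3_def power_divide distrib_right) (simp add: algebra_simps power2_eq_square)
    then show ?thesis using D[of x] by (simp add: power2_eq_square)
  qed
  \<comment> \<open>The Wronskian z2 z3' - z3 z2' vanishes by orthogonality.\<close>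
  have 1: "b2 * a3 = a2 * b3"
  proof -
    have "z2 0 * (p2 0 / (1 - u1 0)) - z3 0 * (- (p3 0 / (1 - u1 0)))
        = (p2 0 * u2 0 + p3 0 * u3 0) / ((1 - u1 0) * (1 - u1 0))"
      by (simp add: z2_def z3_def add_divide_distrib mult.commute)
    also have "\<dots> = 0" by (simp add: orth')
    finally show ?thesis
      unfolding ab2(2) ab3(2) ab2(1) ab3(1) using k(1) by (simp add: algebra_simps)
  qed
  \<comment> \<open>This is |z'|^2 = k^2 |z|^2 + h0 at 0: with vectors a and b, |a - b|^2 - |a +
    b|^2 = - 4 (a . b).\<close>
  have 2: "a2 * b2 + a3 * b3 = - (h0 / (4 * (1 + h0)))"
  proof -
    have "((p3 0)\<^sup>2 + (p2 0)\<^sup>2) = (k\<^sup>2 * ((z2 0)\<^sup>2 + (z3 0)\<^sup>2) + h0) * (1 - u1 0)\<^sup>2"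
      using p_sq[of 0] z_sq[of 0] unfolding k by algebra
    then have "(- (p3 0 / (1 - u1 0)))\<^sup>2 + (p2 0 / (1 - u1 0))\<^sup>2 = k\<^sup>2 * ((z2 0)\<^sup>2 + (z3 0)\<^sup>2) + h0"
      using D[of 0] by (simp add: power_divide add_divide_distrib[symmetric])
    then have "- 4 * k\<^sup>2 * (a2 * b2 + a3 * b3) = h0"
      unfolding ab2(2) ab3(2) ab2(1) ab3(1) by (simp add: algebra_simps power2_eq_square)
    then show ?thesis using h0 unfolding k by (simp add: field_simps)
  qed
  define r where "r = sqrt (b2\<^sup>2 + b3\<^sup>2)"
  \<comment> \<open>Otherwise z tends to 0 at minus infinity, that is, \<open>u1\<close> tends to -1
    instead of 1.\<close>
  have "b2 \<noteq> 0 \<or> b3 \<noteq> 0"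
  proof (rule ccontr)
    assume "\<not> ?thesis"
    then have b: "b2 = 0" "b3 = 0" by auto
    have "filterlim (\<lambda>x. k * x) at_bot at_bot"
      using k(1) filterlim_tendsto_pos_mult_at_bot[OF tendsto_const _ filterlim_ident] by blast
    then have e: "((\<lambda>x. exp (k * x)) \<longlongrightarrow> 0) at_bot"
      using filterlim_compose[OF exp_at_bot] by blast
    have "((\<lambda>x. ((a2 * exp (k * x))\<^sup>2 + (a3 * exp (k * x))\<^sup>2) * (1 - u1 x)) \<longlongrightarrow> ((a2 * 0)\<^sup>2 + (a3 * 0)\<^sup>2) * (1 - 1)) at_bot"
      by (intro tendsto_intros e lim)
    moreover have "((a2 * exp (k * x))\<^sup>2 + (a3 * exp (k * x))\<^sup>2) * (1 - u1 x) = 1 + u1 x" for x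
      using z_sq[of x] by (simp add: ab2(1) ab3(1) b)
    ultimately have "((\<lambda>x. 1 + u1 x) \<longlongrightarrow> 0) at_bot" by simp
    moreover have "((\<lambda>x. 1 + u1 x) \<longlongrightarrow> 1 + 1) at_bot"
      by (intro tendsto_intros lim)
    ultimately show False
      using tendsto_unique[OF trivial_limit_at_bot_linorder] by fastforce
  qed
  then have r: "r > 0" "r\<^sup>2 = b2\<^sup>2 + b3\<^sup>2"
    by (auto simp: r_def sum_power2_gt_zero_iff)
  have "(b2 / r)\<^sup>2 + (b3 / r)\<^sup>2 = (b2\<^sup>2 + b3\<^sup>2) / r\<^sup>2"
    by (simp add: power_divide add_divide_distrib)
  then have "(b2 / r)\<^sup>2 + (b3 / r)\<^sup>2 = 1"
    unfolding r(2)[symmetric] using r(1) by simp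
  then obtain \<phi> where "b2 / r = cos \<phi>" "b3 / r = sin \<phi>"
    using sincos_total_2pi by metis
  then have \<phi>: "b2 = r * cos \<phi>" "b3 = r * sin \<phi>"
    using r(1) by (simp_all add: field_simps)
  \<comment> \<open>The translation that absorbs the length \<open>r\<close> of b; the polar angle
    \<phi> of b is the rotation.\<close>
  define y where "y = ln r / k"
  have y: "exp (- (k * (x - y))) = r * exp (- (k * x))" "exp (k * (x - y)) = exp (k * x) / r" for x
  proof -
    have "k * (x - y) = k * x - ln r"
      using k(1) by (simp add: y_def right_diff_distrib)
    then show "exp (- (k * (x - y))) = r * exp (- (k * x))" "exp (k * (x - y)) = exp (k * x) / r"
      using r(1) by (simp_all add: exp_diff exp_minus divide_inverse)
  qed
  \<comment> \<open>As a is parallel to b, it equals (a . b) b / r^2.\<close>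
  have a: "a2 * r = - (h0 / (4 * (1 + h0))) * cos \<phi>" "a3 * r = - (h0 / (4 * (1 + h0))) * sin \<phi>"
  proof -
    have "a2 * r\<^sup>2 = - (h0 / (4 * (1 + h0))) * b2" "a3 * r\<^sup>2 = - (h0 / (4 * (1 + h0))) * b3"
      unfolding 2[symmetric] r(2) using 1 by algebra+
    then have "a2 * r * r = - (h0 / (4 * (1 + h0))) * cos \<phi> * r" "a3 * r * r = - (h0 / (4 * (1 + h0))) * sin \<phi> * r"
      by (simp_all add: \<phi> power2_eq_square mult.assoc mult.left_commute)
    then show "a2 * r = - (h0 / (4 * (1 + h0))) * cos \<phi>" "a3 * r = - (h0 / (4 * (1 + h0))) * sin \<phi>"
      using r(1) mult_right_cancel by (metis less_irrefl)+
  qed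
  have zeta: "zeta h0 (x - y) = r * exp (- (k * x)) - h0 / (4 * (1 + h0)) * (exp (k * x) / r)" for x
    unfolding zeta_def k_def[symmetric] y ..
  show ?thesis
  proof (rule that[of \<phi> y])
    show "u2 x / (1 - u1 x) = cos \<phi> * zeta h0 (x - y)" for x
    proof -
      have "a2 = - (h0 / (4 * (1 + h0))) * cos \<phi> / r"
        using a(1) r(1) by (metis less_irrefl nonzero_eq_divide_eq)
      then show ?thesis
        using ab2(1)[of x] \<phi>(1) unfolding z2_def zeta by (simp add: algebra_simps)
    qed
    show "u3 x / (1 - u1 x) = sin \<phi> * zeta h0 (x - y)" for x
    proof -
      have "a3 = - (h0 / (4 * (1 + h0))) * sin \<phi> / r"
        using a(2) r(1) by (metis less_irrefl nonzero_eq_divide_eq)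
      then show ?thesis
        using ab3(1)[of x] \<phi>(2) unfolding z3_def zeta by (simp add: algebra_simps)
    qed
  qed
qed

end

section \<open>The explicit profile\<close>

lemma has_vector_derivative_vec3:
  fixes f g h :: "real \<Rightarrow> real"
  assumes "(f has_real_derivative f') (at x)" "(g has_real_derivative g') (at x)" "(h has_real_derivative h') (at x)"
  shows "((\<lambda>x. vector [f x, g x, h x] :: real^3) has_vector_derivative vector [f', g', h']) (at x)"
proof -
  have eq: "(vector [a, b, c] :: real^3) = a *\<^sub>R e1 + b *\<^sub>R e2 + c *\<^sub>R e3" for a b c
    by (simp add: vec_eq_iff forall_3 axis_def)
  have "((\<lambda>x. f x *\<^sub>R e1 + g x *\<^sub>R e2 + h x *\<^sub>R e3) has_vector_derivative
      (f x *\<^sub>R 0 + f' *\<^sub>R e1) + (g x *\<^sub>R 0 + g' *\<^sub>R e2) + (h x *\<^sub>R 0 + h' *\<^sub>R e3)) (at x)"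
    by (intro has_vector_derivative_add has_vector_derivative_scaleR has_vector_derivative_const assms)
  then show ?thesis
    unfolding eq by simp
qed

lemma tendsto_vec3I:
  fixes w :: "'a \<Rightarrow> real^3"
  assumes "((\<lambda>x. w x $ 1) \<longlongrightarrow> l $ 1) F" "((\<lambda>x. w x $ 2) \<longlongrightarrow> l $ 2) F" "((\<lambda>x. w x $ 3) \<longlongrightarrow> l $ 3) F"
  shows "(w \<longlongrightarrow> l) F"
proof (rule vec_tendstoI)
  show "((\<lambda>x. w x $ i) \<longlongrightarrow> l $ i) F" for i
    using exhaust_3[of i] assms by auto
qed

text \<open>The equation stands in divergence form, (w x w')' = - w x (lower field), which matches
  \<open>cross_H\<close> and mentions no second derivative of \<open>w\<close>.\<close>

definition classical_solution :: "real \<Rightarrow> (real \<Rightarrow> real^3) \<Rightarrow> (real \<Rightarrow> real^3) \<Rightarrow> bool" where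
  "classical_solution h0 w d \<longleftrightarrow> (\<forall>x. norm (w x) = 1) \<and> continuous_on UNIV d \<and>
     (\<forall>x. (w has_vector_derivative d x) (at x)) \<and>
     (\<forall>x. ((\<lambda>x. w x \<times> d x) has_vector_derivative - (w x \<times> lower_field h0 (w x))) (at x))"

lemma classical_solution_stationary:
  assumes "classical_solution h0 w d"
  shows "stationary_solution h0 w"
proof -
  have w: "\<And>x. (w has_vector_derivative d x) (at x)" and d: "continuous_on UNIV d"
    and wd: "\<And>x. ((\<lambda>x. w x \<times> d x) has_vector_derivative - (w x \<times> lower_field h0 (w x))) (at x)"
    using assms by (auto simp: classical_solution_def)
  have "continuous_on UNIV w"
    using w by (meson continuous_at_imp_continuous_on has_vector_derivative_continuous)
  then have cont: "continuous_on UNIV (\<lambda>x. - (w x \<times> lower_field h0 (w x)))"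
    unfolding lower_field_def by (intro continuous_intros continuous_on_cross)
  have "cross_H h0 w d \<phi> = 0" if "test_function \<phi>" for \<phi>
    using integral_by_parts_test_function[OF that wd cont]
    by (simp add: cross_H_def cross_add_left cross_mult_left)
  then show ?thesis
    using weak_derivativeI_C1[OF w d] by (auto simp: stationary_solution_def)
qed

lemma classical_solution_H1:
  assumes "classical_solution h0 w d"
    and w23: "integrable lborel (\<lambda>x. (w x $ 2)\<^sup>2 + (w x $ 3)\<^sup>2)" and d2: "integrable lborel (\<lambda>x. (norm (d x))\<^sup>2)"
  shows "w \<in> H1"
proof -
  have w: "\<And>x. (w has_vector_derivative d x) (at x)" and d: "continuous_on UNIV d" and norm: "\<And>x. norm (w x) = 1"
    using assms by (auto simp: classical_solution_def)
  have cont: "continuous_on UNIV w"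
    using w by (meson continuous_at_imp_continuous_on has_vector_derivative_continuous)
  have meas: "(\<lambda>x. w x $ i) \<in> borel_measurable lborel" for i
    using borel_measurable_continuous_onI[OF bounded_linear.continuous_on[OF bounded_linear_vec_nth cont]] by simp
  have "in_L2 (\<lambda>x. w x $ i)" if "i = 2 \<or> i = 3" for i
    unfolding in_L2_def
  proof (intro conjI meas)
    show "integrable lborel (\<lambda>x. (norm (w x $ i))\<^sup>2)"
      by (rule Bochner_Integration.integrable_bound[OF w23])
         (use meas that in auto)
  qed
  moreover have "in_L2 d"
    using d2 borel_measurable_continuous_onI[OF d] by (simp add: in_L2_def)
  ultimately show ?thesis
    using cont norm weak_derivativeI_C1[OF w d] by (auto simp: H1_def)
qed

section \<open>Invariance under translations and rotations\<close>

lemma rot_nth [simp]: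
  "(rot \<phi> *v v) $ 1 = v $ 1"
  "(rot \<phi> *v v) $ 2 = cos \<phi> * v $ 2 - sin \<phi> * v $ 3"
  "(rot \<phi> *v v) $ 3 = sin \<phi> * v $ 2 + cos \<phi> * v $ 3"
  by (simp_all add: rot_def matrix_vector_mult_def sum_3)

lemma rot_cross: "(rot \<phi> *v u) \<times> (rot \<phi> *v v) = rot \<phi> *v (u \<times> v)"
proof -
  have cs: "cos \<phi> * cos \<phi> = 1 - sin \<phi> * sin \<phi>"
    using sin_cos_squared_add[of \<phi>] by (simp add: power2_eq_square)
  show ?thesis
    unfolding vec_eq_iff forall_3 cross_components rot_nth by (intro conjI) (use cs in algebra)+
qed

lemma rot_sq: "(cos \<phi> * a - sin \<phi> * b)\<^sup>2 + (sin \<phi> * a + cos \<phi> * b)\<^sup>2 = a\<^sup>2 + b\<^sup>2" for a b :: real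
  using sin_cos_squared_add[of \<phi>] by algebra

lemma norm_rot: "norm (rot \<phi> *v v) = norm v"
  unfolding norm_eq_sqrt_inner inner_vec_def sum_3 rot_nth
  using rot_sq[of \<phi> "v $ 2" "v $ 3"] by (simp add: power2_eq_square add.assoc)

lemma lower_field_nth [simp]:
  "lower_field h0 v $ 1 = h0" "lower_field h0 v $ 2 = - v $ 2" "lower_field h0 v $ 3 = - v $ 3"
  by (simp_all add: lower_field_def axis_def)

lemma lower_field_rot: "lower_field h0 (rot \<phi> *v v) = rot \<phi> *v lower_field h0 v"
  by (simp add: vec_eq_iff forall_3)

lemma has_vector_derivative_act:
  assumes "\<And>x. (w has_vector_derivative d x) (at x)"
  shows "(act g w has_vector_derivative act g d x) (at x)"
proof -
  have "((w \<circ> (\<lambda>x. x - fst g)) has_vector_derivative 1 *\<^sub>R d (x - fst g)) (at x)"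
    by (rule vector_diff_chain_at[OF _ assms]) (auto intro!: derivative_eq_intros)
  then have "((\<lambda>x. w (x - fst g)) has_vector_derivative d (x - fst g)) (at x)"
    by (simp add: comp_def)
  from bounded_linear.has_vector_derivative[OF matrix_vector_mul_bounded_linear this, of "rot (snd g)"]
  show ?thesis
    by (simp add: act_def[abs_def])
qed

lemma classical_solution_act:
  assumes "classical_solution h0 w d"
  shows "classical_solution h0 (act g w) (act g d)"
proof -
  have w: "\<And>x. (w has_vector_derivative d x) (at x)" and d: "continuous_on UNIV d" and norm: "\<And>x. norm (w x) = 1"
    and wd: "\<And>x. ((\<lambda>x. w x \<times> d x) has_vector_derivative - (w x \<times> lower_field h0 (w x))) (at x)"
    using assms by (auto simp: classical_solution_def)
  have "continuous_on UNIV (act g d)"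
    unfolding act_def
    by (intro bounded_linear.continuous_on[OF matrix_vector_mul_bounded_linear] continuous_on_compose2[OF d] continuous_intros) auto
  moreover have "(\<lambda>x. act g w x \<times> act g d x) = act g (\<lambda>x. w x \<times> d x)"
    by (simp add: act_def rot_cross)
  moreover have "- (act g w x \<times> lower_field h0 (act g w x)) = act g (\<lambda>x. - (w x \<times> lower_field h0 (w x))) x" for x
  proof -
    have "- (rot \<phi> *v v) = rot \<phi> *v (- v)" for \<phi> v
      by (simp add: vec_eq_iff forall_3)
    then show ?thesis
      by (simp add: act_def lower_field_rot rot_cross)
  qed
  ultimately show ?thesis
    using has_vector_derivative_act[OF w] has_vector_derivative_act[OF wd] norm
    by (simp add: classical_solution_def) (simp add: act_def norm_rot)
qed

text \<open>The inverse stereographic projection from \<open>e1\<close> of the point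
  \<open>zeta h0 x\<close> on the first axis of the plane; the curve runs on a great circle.\<close>

definition wall :: "real \<Rightarrow> real \<Rightarrow> real^3" where
  "wall h0 x = vector [1 - 2 / (1 + (zeta h0 x)\<^sup>2), 2 * zeta h0 x / (1 + (zeta h0 x)\<^sup>2), 0]"

definition zeta' :: "real \<Rightarrow> real \<Rightarrow> real" where
  "zeta' h0 x = - sqrt (1 + h0) * (exp (- (sqrt (1 + h0) * x)) + h0 / (4 * (1 + h0)) * exp (sqrt (1 + h0) * x))"

text \<open>Factored so that the speed is visible: the vector has norm
  \<open>1 + (zeta h0 x)\<^sup>2\<close>.\<close>

definition wall' :: "real \<Rightarrow> real \<Rightarrow> real^3" where
  "wall' h0 x = (2 * zeta' h0 x / (1 + (zeta h0 x)\<^sup>2)\<^sup>2) *\<^sub>R vector [2 * zeta h0 x, 1 - (zeta h0 x)\<^sup>2, 0]"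

lemma zeta_deriv: "(zeta h0 has_real_derivative zeta' h0 x) (at x)"
proof -
  have "((\<lambda>x. exp (- (k * x)) - c * exp (k * x)) has_real_derivative - k * (exp (- (k * x)) + c * exp (k * x))) (at x)" for k c
    by (auto intro!: derivative_eq_intros simp: algebra_simps)
  then show ?thesis
    unfolding zeta_def[abs_def] zeta'_def by blast
qed

lemma zeta'_deriv:
  assumes "h0 > -1"
  shows "(zeta' h0 has_real_derivative (1 + h0) * zeta h0 x) (at x)"
proof -
  have deriv: "((\<lambda>x. - k * (exp (- (k * x)) + c * exp (k * x))) has_real_derivative k * k * (exp (- (k * x)) - c * exp (k * x))) (at x)" for k c
    by (auto intro!: derivative_eq_intros simp: algebra_simps)
  have "sqrt (1 + h0) * sqrt (1 + h0) = 1 + h0"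
    using assms by simp
  from deriv[of "sqrt (1 + h0)" "h0 / (4 * (1 + h0))", unfolded this] show ?thesis
    unfolding zeta_def zeta'_def[abs_def] .
qed

text \<open>With E F = 1, the squares of E + c F and E - c F differ by 4 c, and the constant c in
  \<open>zeta\<close> satisfies 4 (1 + h0) c = h0.\<close>

lemma zeta'_sq:
  assumes "h0 > -1"
  shows "(zeta' h0 x)\<^sup>2 = (1 + h0) * (zeta h0 x)\<^sup>2 + h0"
proof -
  define E F c where "E = exp (- (sqrt (1 + h0) * x))" and "F = exp (sqrt (1 + h0) * x)" and "c = h0 / (4 * (1 + h0))"
  have EF: "E * F = 1" by (simp add: E_def F_def flip: exp_add)
  have c: "4 * (1 + h0) * c = h0" using assms by (simp add: c_def)
  have "(zeta' h0 x)\<^sup>2 = (1 + h0) * (E + c * F)\<^sup>2"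
    using assms by (simp add: zeta'_def E_def F_def c_def power_mult_distrib)
  also have "\<dots> = (1 + h0) * (E - c * F)\<^sup>2 + h0"
    using EF c by algebra
  finally show ?thesis
    by (simp add: zeta_def E_def F_def c_def)
qed

lemma one_plus_sq_pos: "1 + (x::real)\<^sup>2 > 0"
  using zero_le_power2[of x] by linarith

lemma classical_solution_wall:
  assumes "h0 > -1"
  shows "classical_solution h0 (wall h0) (wall' h0)"
proof -
  let ?z = "zeta h0" and ?z' = "zeta' h0"
  have pos: "1 + (?z x)\<^sup>2 \<noteq> 0" for x using one_plus_sq_pos[of "?z x"] by simp
  have "norm (wall h0 x) = 1" for x
  proof -
    have "(1 - 2 / (1 + (?z x)\<^sup>2))\<^sup>2 + (2 * ?z x / (1 + (?z x)\<^sup>2))\<^sup>2 = 1"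
      using pos[of x] by (simp add: divide_simps) algebra
    then show ?thesis
      by (simp add: norm_eq_sqrt_inner inner_vec_def sum_3 wall_def power2_eq_square)
  qed
  moreover have "continuous_on UNIV (wall' h0)"
  proof -
    have "continuous_on UNIV ?z" "continuous_on UNIV ?z'"
      unfolding zeta_def zeta'_def by (intro continuous_intros)+
    moreover have "(vector [a, b, 0] :: real^3) = a *\<^sub>R e1 + b *\<^sub>R e2" for a b
      by (simp add: vec_eq_iff forall_3 axis_def)
    ultimately show ?thesis
      unfolding wall'_def using pos by (auto intro!: continuous_intros)
  qed
  moreover have "(wall h0 has_vector_derivative wall' h0 x) (at x)" for x
  proof -
    have "((\<lambda>x. 1 - 2 / (1 + (?z x)\<^sup>2)) has_real_derivative 4 * ?z x * ?z' x / (1 + (?z x)\<^sup>2)\<^sup>2) (at x)"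
      by (rule derivative_eq_intros refl zeta_deriv pos | simp)+
         (simp add: power2_eq_square field_simps)
    moreover have "((\<lambda>x. 2 * ?z x / (1 + (?z x)\<^sup>2)) has_real_derivative 2 * ?z' x * (1 - (?z x)\<^sup>2) / (1 + (?z x)\<^sup>2)\<^sup>2) (at x)"
      by (rule derivative_eq_intros refl zeta_deriv pos | simp)+
         (simp add: power2_eq_square field_simps)
    ultimately have "(wall h0 has_vector_derivative vector [4 * ?z x * ?z' x / (1 + (?z x)\<^sup>2)\<^sup>2,
        2 * ?z' x * (1 - (?z x)\<^sup>2) / (1 + (?z x)\<^sup>2)\<^sup>2, 0]) (at x)"
      unfolding wall_def[abs_def] by (rule has_vector_derivative_vec3) simp
    also have "vector [4 * ?z x * ?z' x / (1 + (?z x)\<^sup>2)\<^sup>2, 2 * ?z' x * (1 - (?z x)\<^sup>2) / (1 + (?z x)\<^sup>2)\<^sup>2, 0] = wall' h0 x"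
      by (simp add: wall'_def vec_eq_iff forall_3)
    finally show ?thesis .
  qed
  moreover have "((\<lambda>x. wall h0 x \<times> wall' h0 x) has_vector_derivative
      - (wall h0 x \<times> lower_field h0 (wall h0 x))) (at x)" for x
  proof -
    \<comment> \<open>The profile stays in the plane of \<open>e1\<close> and \<open>e2\<close>, so
      w x w' has only a third coordinate, computed here.\<close>
    have "(1 - 2 / (1 + z\<^sup>2)) * (2 * z' / (1 + z\<^sup>2)\<^sup>2 * (1 - z\<^sup>2)) - 2 * z' / (1 + z\<^sup>2)\<^sup>2 * (2 * z) * (2 * z / (1 + z\<^sup>2))
        = - (2 * z' / (1 + z\<^sup>2))" for z z' :: real
    proof -
      have "1 + z\<^sup>2 \<noteq> 0" using one_plus_sq_pos[of z] by simp
      then show ?thesis by (simp add: divide_simps) algebra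
    qed
    then have "(\<lambda>x. wall h0 x \<times> wall' h0 x) = (\<lambda>x. vector [0, 0, - (2 * ?z' x / (1 + (?z x)\<^sup>2))])"
      by (simp add: fun_eq_iff vec_eq_iff forall_3 cross_components wall_def wall'_def)
    moreover have "((\<lambda>x. - (2 * ?z' x / (1 + (?z x)\<^sup>2))) has_real_derivative
        2 * ?z x / (1 + (?z x)\<^sup>2) * (h0 + (1 - 2 / (1 + (?z x)\<^sup>2)))) (at x)"
    proof -
      have "((\<lambda>x. - (2 * ?z' x / (1 + (?z x)\<^sup>2))) has_real_derivative
          - ((2 * ((1 + h0) * ?z x) * (1 + (?z x)\<^sup>2) - 2 * ?z' x * (0 + 2 * ?z x * ?z' x)) / ((1 + (?z x)\<^sup>2) * (1 + (?z x)\<^sup>2)))) (at x)"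
        by (rule derivative_eq_intros refl zeta_deriv zeta'_deriv assms pos | simp)+
      \<comment> \<open>Substituting for z'^2 makes the numerator z times an affine function of
        \<open>1 + (?z x)\<^sup>2\<close>, and one factor of the denominator cancels.\<close>
      moreover have "2 * ((1 + h0) * ?z x) * (1 + (?z x)\<^sup>2) - 2 * ?z' x * (0 + 2 * ?z x * ?z' x)
          = - (2 * ?z x * (h0 * (1 + (?z x)\<^sup>2) + ((1 + (?z x)\<^sup>2) - 2)))"
        using zeta'_sq[OF assms, of x] by algebra
      ultimately show ?thesis
        using pos[of x] by (simp add: divide_simps)
    qed
    ultimately have "((\<lambda>x. wall h0 x \<times> wall' h0 x) has_vector_derivative vector [0, 0,
        2 * ?z x / (1 + (?z x)\<^sup>2) * (h0 + (1 - 2 / (1 + (?z x)\<^sup>2)))]) (at x)"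
      using has_vector_derivative_vec3[of "\<lambda>_. 0" 0 x "\<lambda>_. 0" 0] by simp
    also have "vector [0, 0, 2 * ?z x / (1 + (?z x)\<^sup>2) * (h0 + (1 - 2 / (1 + (?z x)\<^sup>2)))]
        = - (wall h0 x \<times> lower_field h0 (wall h0 x))"
      by (simp add: vec_eq_iff forall_3 cross_components wall_def algebra_simps add_divide_distrib diff_divide_distrib)
    finally show ?thesis .
  qed
  ultimately show ?thesis
    by (simp add: classical_solution_def)
qed

text \<open>These bounds compare the squares of \<open>w $ 2\<close> and of the speed with 1 / (1 +
  x^2). For h0 \<noteq> 0 both exponentials in \<open>zeta\<close> are present, and 1 + zeta^2
  itself dominates a multiple of 1 + x^2. For h0 = 0 this fails at plus infinity, where
  \<open>zeta\<close> tends to 0, so the decay of the numerator is used instead.\<close>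

lemma zeta_bounds:
  assumes "h0 > -1"
  obtains C where "\<And>x. (1 + x\<^sup>2) * (zeta h0 x)\<^sup>2 \<le> C * (1 + (zeta h0 x)\<^sup>2)\<^sup>2"
    "\<And>x. (1 + x\<^sup>2) * (zeta' h0 x)\<^sup>2 \<le> C * (1 + (zeta h0 x)\<^sup>2)\<^sup>2"
proof (cases "h0 = 0")
  case True
  have "(1 + x\<^sup>2) * (zeta h0 x)\<^sup>2 \<le> (1 + (zeta h0 x)\<^sup>2)\<^sup>2" for x
  proof -
    have z: "zeta h0 x = exp (- x)" by (simp add: zeta_def True)
    have "1 + x\<^sup>2 \<le> (1 + \<bar>x\<bar>)\<^sup>2"
      by (simp add: power2_eq_square algebra_simps)
    also have "1 + \<bar>x\<bar> \<le> exp x + exp (- x)"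
      using exp_ge_add_one_self[of x] exp_ge_add_one_self[of "-x"] exp_gt_zero[of x] exp_gt_zero[of "-x"] by linarith
    then have "(1 + \<bar>x\<bar>)\<^sup>2 \<le> (exp x + exp (- x))\<^sup>2"
      by (rule power_mono) simp
    finally have "(1 + x\<^sup>2) * (exp (- x))\<^sup>2 \<le> (exp x + exp (- x))\<^sup>2 * (exp (- x))\<^sup>2"
      by (rule mult_right_mono) simp
    also have "\<dots> = (1 + (exp (- x))\<^sup>2)\<^sup>2"
    proof -
      have "exp x * exp (- x) = 1" by (simp flip: exp_add)
      then show ?thesis by algebra
    qed
    finally show ?thesis unfolding z .
  qed
  moreover have "(zeta' h0 x)\<^sup>2 = (zeta h0 x)\<^sup>2" for x
    using zeta'_sq[OF assms, of x] by (simp add: True)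
  ultimately show ?thesis
    using that[of 1] by simp
next
  case False
  define k c where "k = sqrt (1 + h0)" and "c = h0 / (4 * (1 + h0))"
  have k: "k > 0" and c: "c \<noteq> 0" "0 \<le> 1 - 2 * c"
    using assms False by (simp_all add: k_def c_def field_simps)
  \<comment> \<open>The first factor bounds the coefficients 1 and c^2 of the two squared
    exponentials from below, the second one trades 1 + k^2 x^2 for 1 + x^2. The cross term of zeta^2
    is the constant - 2 c, harmless because \<open>1 - 2 * c\<close> is nonnegative.\<close>
  define \<mu> where "\<mu> = min 1 (c\<^sup>2) * min 1 (k\<^sup>2)"
  have \<mu>: "\<mu> > 0" using k c by (simp add: \<mu>_def)
  have lower: "\<mu> * (1 + x\<^sup>2) \<le> 1 + (zeta h0 x)\<^sup>2" for x
  proof -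
    define E F where "E = exp (- (k * x))" and "F = exp (k * x)"
    have EF: "E * F = 1" by (simp add: E_def F_def flip: exp_add)
    have "\<mu> * (1 + x\<^sup>2) = min 1 (c\<^sup>2) * (min 1 (k\<^sup>2) * 1 + min 1 (k\<^sup>2) * x\<^sup>2)"
      by (simp add: \<mu>_def distrib_left)
    also have "\<dots> \<le> min 1 (c\<^sup>2) * (1 + k\<^sup>2 * x\<^sup>2)"
      by (intro mult_left_mono add_mono mult_right_mono) auto
    also have "1 + k\<^sup>2 * x\<^sup>2 \<le> (1 + \<bar>k * x\<bar>)\<^sup>2"
      by (simp add: power2_eq_square algebra_simps)
    also have "min 1 (c\<^sup>2) * (1 + \<bar>k * x\<bar>)\<^sup>2 \<le> E\<^sup>2 + c\<^sup>2 * F\<^sup>2"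
    proof (cases "x \<ge> 0")
      case True
      then have "1 + \<bar>k * x\<bar> \<le> F"
        using k exp_ge_add_one_self[of "k * x"] by (simp add: F_def)
      then have "(1 + \<bar>k * x\<bar>)\<^sup>2 \<le> F\<^sup>2"
        by (rule power_mono) simp
      then have "min 1 (c\<^sup>2) * (1 + \<bar>k * x\<bar>)\<^sup>2 \<le> c\<^sup>2 * F\<^sup>2"
        by (intro mult_mono) auto
      then show ?thesis by (simp add: add_increasing)
    next
      case False
      then have "1 + \<bar>k * x\<bar> \<le> E"
        using k exp_ge_add_one_self[of "- (k * x)"] by (simp add: E_def abs_mult)
      then have "(1 + \<bar>k * x\<bar>)\<^sup>2 \<le> E\<^sup>2"
        by (rule power_mono) simp
      then have "min 1 (c\<^sup>2) * (1 + \<bar>k * x\<bar>)\<^sup>2 \<le> 1 * E\<^sup>2"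
        by (intro mult_mono) auto
      then show ?thesis by (simp add: add_increasing2)
    qed
    also have "\<dots> \<le> E\<^sup>2 + c\<^sup>2 * F\<^sup>2 + (1 - 2 * c)"
      using c by simp
    also have "\<dots> = 1 + (E - c * F)\<^sup>2"
      using EF by algebra
    also have "E - c * F = zeta h0 x"
      by (simp add: zeta_def E_def F_def k_def c_def)
    finally show ?thesis by (simp add: mult_left_mono)
  qed
  define M where "M = 2 + h0 + \<bar>h0\<bar>"
  have "(1 + x\<^sup>2) * a \<le> M / \<mu> * (1 + (zeta h0 x)\<^sup>2)\<^sup>2" if "a \<le> M * (1 + (zeta h0 x)\<^sup>2)" for x a
  proof -
    let ?q = "1 + (zeta h0 x)\<^sup>2"
    have M: "M > 0" using assms by (simp add: M_def)
    have "(1 + x\<^sup>2) * a \<le> (1 + x\<^sup>2) * (M * ?q)"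
      using that by (intro mult_left_mono) auto
    also have "1 + x\<^sup>2 \<le> ?q / \<mu>"
      using lower[of x] \<mu> by (simp add: pos_le_divide_eq mult.commute)
    then have "(1 + x\<^sup>2) * (M * ?q) \<le> ?q / \<mu> * (M * ?q)"
      using M by (intro mult_right_mono) auto
    finally show ?thesis by (simp add: power2_eq_square mult_ac)
  qed
  note bound = this
  show ?thesis
  proof (rule that[of "M / \<mu>"]; rule bound)
    show "(zeta h0 x)\<^sup>2 \<le> M * (1 + (zeta h0 x)\<^sup>2)" for x
    proof -
      have "1 * (zeta h0 x)\<^sup>2 \<le> M * (1 + (zeta h0 x)\<^sup>2)"
        using assms by (intro mult_mono) (auto simp: M_def)
      then show ?thesis by simp
    qed
    show "(zeta' h0 x)\<^sup>2 \<le> M * (1 + (zeta h0 x)\<^sup>2)" for x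
    proof -
      have "(1 + h0) * (zeta h0 x)\<^sup>2 + h0 \<le> M * (zeta h0 x)\<^sup>2 + M"
        using assms by (intro add_mono mult_right_mono) (auto simp: M_def)
      then show ?thesis by (simp add: zeta'_sq[OF assms] distrib_left)
    qed
  qed
qed

section \<open>Square integrability and the limit of the profile\<close>

lemma integrable_inverse_one_plus_sq: "integrable lborel (\<lambda>x::real. inverse (1 + x\<^sup>2))"
  using integrable_inverse_1_plus_square by (simp add: set_integrable_def einterval_def)

lemma integrable_wall:
  assumes "h0 > -1"
  shows "integrable lborel (\<lambda>x. (wall h0 x $ 2)\<^sup>2 + (wall h0 x $ 3)\<^sup>2)"
    and "integrable lborel (\<lambda>x. (norm (wall' h0 x))\<^sup>2)"
proof -
  obtain C where C: "\<And>x. (1 + x\<^sup>2) * (zeta h0 x)\<^sup>2 \<le> C * (1 + (zeta h0 x)\<^sup>2)\<^sup>2"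
    "\<And>x. (1 + x\<^sup>2) * (zeta' h0 x)\<^sup>2 \<le> C * (1 + (zeta h0 x)\<^sup>2)\<^sup>2"
    by (rule zeta_bounds[OF assms]) (rule that)
  have cont: "continuous_on UNIV (zeta h0)" "continuous_on UNIV (zeta' h0)"
    unfolding zeta_def zeta'_def by (intro continuous_intros)+
  have int: "integrable lborel (\<lambda>x. (2 * f x / (1 + (zeta h0 x)\<^sup>2))\<^sup>2)"
    if f: "continuous_on UNIV f" "\<And>x. (1 + x\<^sup>2) * (f x)\<^sup>2 \<le> C * (1 + (zeta h0 x)\<^sup>2)\<^sup>2" for f
  proof (rule Bochner_Integration.integrable_bound)
    show "integrable lborel (\<lambda>x::real. 4 * C * inverse (1 + x\<^sup>2))"
      using integrable_inverse_one_plus_sq by simp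
    have "continuous_on UNIV (\<lambda>x. (2 * f x / (1 + (zeta h0 x)\<^sup>2))\<^sup>2)"
      using one_plus_sq_pos by (intro continuous_intros f cont) (metis less_irrefl)
    then show "(\<lambda>x. (2 * f x / (1 + (zeta h0 x)\<^sup>2))\<^sup>2) \<in> borel_measurable lborel"
      using borel_measurable_continuous_onI by simp
    show "AE x in lborel. norm ((2 * f x / (1 + (zeta h0 x)\<^sup>2))\<^sup>2) \<le> norm (4 * C * inverse (1 + x\<^sup>2))"
    proof (rule AE_I2)
      fix x
      define q where "q = (1 + (zeta h0 x)\<^sup>2)\<^sup>2"
      have q: "q > 0" using one_plus_sq_pos[of "zeta h0 x"] by (simp add: q_def)
      have "(f x)\<^sup>2 * (1 + x\<^sup>2) \<le> C * q"
        using f(2)[of x] by (simp add: q_def mult.commute)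
      then have "(f x)\<^sup>2 / q \<le> C / (1 + x\<^sup>2)"
        using q one_plus_sq_pos[of x] by (simp add: divide_le_eq pos_le_divide_eq mult.commute)
      then have "(2 * f x / (1 + (zeta h0 x)\<^sup>2))\<^sup>2 \<le> 4 * C * inverse (1 + x\<^sup>2)"
        by (simp add: q_def power_divide power_mult_distrib divide_inverse power_inverse)
      then show "norm ((2 * f x / (1 + (zeta h0 x)\<^sup>2))\<^sup>2) \<le> norm (4 * C * inverse (1 + x\<^sup>2))"
        unfolding real_norm_def abs_of_nonneg[OF zero_le_power2] by linarith
    qed
  qed
  show "integrable lborel (\<lambda>x. (wall h0 x $ 2)\<^sup>2 + (wall h0 x $ 3)\<^sup>2)"
    using int[OF cont(1) C(1)] by (simp add: wall_def)
  have "(norm (wall' h0 x))\<^sup>2 = (2 * zeta' h0 x / (1 + (zeta h0 x)\<^sup>2))\<^sup>2" for x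
  proof -
    define q where "q = 1 + (zeta h0 x)\<^sup>2"
    have q: "q \<noteq> 0" using one_plus_sq_pos[of "zeta h0 x"] by (simp add: q_def)
    have "(norm (vector [2 * zeta h0 x, 1 - (zeta h0 x)\<^sup>2, 0] :: real^3))\<^sup>2 = q\<^sup>2"
      unfolding power2_norm_eq_inner inner_vec_def sum_3 q_def by (simp add: power2_eq_square algebra_simps)
    then have "(norm (wall' h0 x))\<^sup>2 = (2 * zeta' h0 x / q\<^sup>2)\<^sup>2 * q\<^sup>2"
      by (simp only: wall'_def norm_scaleR power_mult_distrib power2_abs q_def[symmetric])
    also have "\<dots> = (2 * zeta' h0 x / q\<^sup>2 * q)\<^sup>2"
      by (rule power_mult_distrib[symmetric])
    also have "2 * zeta' h0 x / q\<^sup>2 * q = 2 * zeta' h0 x / q"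
      using q by (simp add: power2_eq_square)
    finally show ?thesis
      by (simp add: q_def)
  qed
  then show "integrable lborel (\<lambda>x. (norm (wall' h0 x))\<^sup>2)"
    using int[OF cont(2) C(2)] by simp
qed

lemma wall_tendsto:
  assumes "h0 > -1"
  shows "(wall h0 \<longlongrightarrow> e1) at_bot"
proof -
  define k where "k = sqrt (1 + h0)"
  have k: "k > 0" using assms by (simp add: k_def)
  have kx: "filterlim (\<lambda>x. k * x) at_bot at_bot"
    using k filterlim_tendsto_pos_mult_at_bot[OF tendsto_const _ filterlim_ident] by blast
  have "((\<lambda>x. - (h0 / (4 * (1 + h0)) * exp (k * x))) \<longlongrightarrow> - (h0 / (4 * (1 + h0)) * 0)) at_bot"
    by (intro tendsto_intros filterlim_compose[OF exp_at_bot kx])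
  moreover have "filterlim (\<lambda>x. - (k * x)) at_top at_bot"
    using kx by (subst filterlim_uminus_at_top) simp
  then have "filterlim (\<lambda>x. exp (- (k * x))) at_top at_bot"
    by (rule filterlim_compose[OF exp_at_top])
  ultimately have "filterlim (\<lambda>x. - (h0 / (4 * (1 + h0)) * exp (k * x)) + exp (- (k * x))) at_top at_bot"
    by (rule filterlim_tendsto_add_at_top)
  then have z: "filterlim (zeta h0) at_top at_bot"
    by (simp add: zeta_def[abs_def] k_def)
  have "((\<lambda>z::real. 1 - 2 / (1 + z\<^sup>2)) \<longlongrightarrow> 1) at_top" "((\<lambda>z::real. 2 * z / (1 + z\<^sup>2)) \<longlongrightarrow> 0) at_top"
    by real_asymp+
  from this[THEN filterlim_compose, OF z] show ?thesis
    by (intro tendsto_vec3I) (simp_all add: wall_def axis_def)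
qed

section \<open>Classification of the stationary solutions\<close>

lemma wall_nth_1_less: "wall h0 x $ 1 < 1"
  using one_plus_sq_pos[of "zeta h0 x"] by (simp add: wall_def)

lemma act_nth_1: "act g w x $ 1 = w (x - fst g) $ 1"
  by (simp add: act_def)

lemma act_wall:
  assumes h0: "h0 > -1"
  shows "act g (wall h0) \<in> H1" "stationary_solution h0 (act g (wall h0))" "(act g (wall h0) \<longlongrightarrow> e1) at_bot"
    "\<not> act g (wall h0) constant_on UNIV"
proof -
  have shift: "integrable lborel (\<lambda>x. f (x - y))" if "integrable lborel f" for f :: "real \<Rightarrow> real" and y
    using lborel_integrable_real_affine[OF that, of 1 "-y"] by simp
  note classical = classical_solution_act[OF classical_solution_wall[OF h0], of g]
  show "stationary_solution h0 (act g (wall h0))"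
    by (rule classical_solution_stationary[OF classical])
  show "act g (wall h0) \<in> H1"
  proof (rule classical_solution_H1[OF classical])
    show "integrable lborel (\<lambda>x. (act g (wall h0) x $ 2)\<^sup>2 + (act g (wall h0) x $ 3)\<^sup>2)"
      using shift[OF integrable_wall(1)[OF h0]] by (simp add: act_def rot_sq)
    show "integrable lborel (\<lambda>x. (norm (act g (wall' h0) x))\<^sup>2)"
      using shift[OF integrable_wall(2)[OF h0]] by (simp add: act_def norm_rot)
  qed
  have "filterlim (\<lambda>x. x - fst g) at_bot at_bot"
    by real_asymp
  from filterlim_compose[OF wall_tendsto[OF h0] this]
  have "((\<lambda>x. rot (snd g) *v wall h0 (x - fst g)) \<longlongrightarrow> rot (snd g) *v e1) at_bot"
    by (rule bounded_linear.tendsto[OF matrix_vector_mul_bounded_linear])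
  moreover have "rot (snd g) *v e1 = e1"
    by (simp add: vec_eq_iff forall_3 axis_def)
  ultimately show lim: "(act g (wall h0) \<longlongrightarrow> e1) at_bot"
    by (simp add: act_def[abs_def])
  show "\<not> act g (wall h0) constant_on UNIV"
  proof
    assume "act g (wall h0) constant_on UNIV"
    then obtain c where c: "act g (wall h0) = (\<lambda>x. c)" by (auto simp: constant_on_def)
    \<comment> \<open>A constant must equal the limit \<open>e1\<close>, whereas the first
      coordinate of \<open>wall\<close> stays below 1.\<close>
    from lim have "c = e1"
      unfolding c by (simp add: tendsto_const_iff)
    then have "act g (wall h0) 0 $ 1 = 1" by (simp add: c axis_def)
    then show False
      using wall_nth_1_less[of h0 "0 - fst g"] unfolding act_nth_1 by simp
  qed
qed

lemma stationary_solution_cases: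
  assumes "w \<in> H1" "stationary_solution h0 w" "(w \<longlongrightarrow> e1) at_bot"
  shows "w = (\<lambda>x. e1) \<or> h0 > -1 \<and> (\<exists>g. w = act g (wall h0))"
proof -
  obtain P where P: "\<And>x. (w has_vector_derivative P x \<times> w x) (at x)"
    "\<And>x. (P has_vector_derivative - (w x \<times> lower_field h0 (w x))) (at x)"
    "\<And>x. P x \<bullet> w x = 0"
    by (rule stationary_solution_regular[OF assms(1,2)]) (rule that)
  have norm_w: "w x \<bullet> w x = 1" for x
    using assms(1) by (auto simp: H1_def subset_iff norm_eq_1)
  have nth: "((\<lambda>x. f x $ i) has_real_derivative f' $ i) (at x)"
    if "(f has_vector_derivative f') (at x)" for f :: "real \<Rightarrow> real^3" and f' x i
    unfolding has_real_derivative_iff_has_vector_derivative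
    by (rule bounded_linear.has_vector_derivative[OF bounded_linear_vec_nth that])
  interpret stationary_profile h0 "\<lambda>x. w x $ 1" "\<lambda>x. w x $ 2" "\<lambda>x. w x $ 3" "\<lambda>x. P x $ 1" "\<lambda>x. P x $ 2" "\<lambda>x. P x $ 3"
  proof
    fix x
    show "((\<lambda>x. w x $ 1) has_real_derivative P x $ 2 * w x $ 3 - P x $ 3 * w x $ 2) (at x)"
      "((\<lambda>x. w x $ 2) has_real_derivative P x $ 3 * w x $ 1 - P x $ 1 * w x $ 3) (at x)"
      "((\<lambda>x. w x $ 3) has_real_derivative P x $ 1 * w x $ 2 - P x $ 2 * w x $ 1) (at x)"
      using nth[OF P(1)[of x], of 1] nth[OF P(1)[of x], of 2] nth[OF P(1)[of x], of 3]
      by (simp_all add: cross_components mult.commute)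
    show "((\<lambda>x. P x $ 1) has_real_derivative 0) (at x)"
      "((\<lambda>x. P x $ 2) has_real_derivative - (w x $ 3 * (h0 + w x $ 1))) (at x)"
      "((\<lambda>x. P x $ 3) has_real_derivative w x $ 2 * (h0 + w x $ 1)) (at x)"
      using nth[OF P(2)[of x], of 1] nth[OF P(2)[of x], of 2] nth[OF P(2)[of x], of 3]
      by (simp_all add: cross_components algebra_simps)
    show "(w x $ 1)\<^sup>2 + (w x $ 2)\<^sup>2 + (w x $ 3)\<^sup>2 = 1"
      using norm_w[of x] by (simp add: inner_vec_def sum_3 power2_eq_square)
    show "P x $ 1 * w x $ 1 + P x $ 2 * w x $ 2 + P x $ 3 * w x $ 3 = 0"
      using P(3)[of x] by (simp add: inner_vec_def sum_3)
    show "((\<lambda>x. w x $ 1) \<longlongrightarrow> 1) at_bot"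
      using tendsto_vec_nth[OF assms(3), of 1] by (simp add: axis_def)
  qed
  from u1_eq_1_or show ?thesis
  proof
    assume 1: "\<forall>x. w x $ 1 = 1"
    have "w x = e1" for x
      using unit[of x] 1 by (simp add: vec_eq_iff forall_3 axis_def)
    then show ?thesis by auto
  next
    assume "\<forall>x. w x $ 1 < 1"
    then have lt: "w x $ 1 < 1" for x by blast
    obtain y \<phi> where z: "\<And>x. w x $ 2 / (1 - w x $ 1) = cos \<phi> * zeta h0 (x - y)"
      "\<And>x. w x $ 3 / (1 - w x $ 1) = sin \<phi> * zeta h0 (x - y)"
      by (rule stereographic[OF lt]) (rule that)
    have "w x = act (y, \<phi>) (wall h0) x" for x
    proof -
      \<comment> \<open>Inverting the projection: unit length gives a quadratic equation for
        \<open>D\<close> whose root 0 is excluded by \<open>lt\<close>, and \<open>D\<close> then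
        determines all three coordinates.\<close>
      define D \<zeta> where "D = 1 - w x $ 1" and "\<zeta> = zeta h0 (x - y)"
      have D: "D > 0" using lt by (simp add: D_def)
      have w2: "w x $ 2 = cos \<phi> * \<zeta> * D" and w3: "w x $ 3 = sin \<phi> * \<zeta> * D"
        using z[of x] D by (simp_all add: D_def[symmetric] \<zeta>_def field_simps)
      have "(w x $ 2)\<^sup>2 + (w x $ 3)\<^sup>2 = \<zeta>\<^sup>2 * D\<^sup>2"
        unfolding w2 w3 using sin_cos_squared_add[of \<phi>] by algebra
      then have "(1 - D)\<^sup>2 + \<zeta>\<^sup>2 * D\<^sup>2 = 1"
        using unit[of x] by (simp add: D_def)
      then have "D * (D * (1 + \<zeta>\<^sup>2) - 2) = 0"
        by algebra
      then have "D = 2 / (1 + \<zeta>\<^sup>2)"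
        using D one_plus_sq_pos[of \<zeta>] by (simp add: eq_divide_eq)
      then have *: "2 / (1 + \<zeta>\<^sup>2) = D" by simp
      have "2 * \<zeta> / (1 + \<zeta>\<^sup>2) = \<zeta> * D"
        unfolding *[symmetric] by simp
      then show ?thesis
        using w2 w3 * by (simp add: vec_eq_iff forall_3 act_def wall_def \<zeta>_def[symmetric] D_def)
    qed
    then show ?thesis
      using h0_gt_if_nonconstant lt by blast
  qed
qed

lemma constant_solution:
  "(\<lambda>x. e1) \<in> H1" "stationary_solution h0 (\<lambda>x. e1)"
proof -
  have "e1 \<times> lower_field h0 e1 = 0"
    by (simp add: vec_eq_iff forall_3 cross_components axis_def)
  then have classical: "classical_solution h0 (\<lambda>x. e1) (\<lambda>x. 0)"
    by (simp add: classical_solution_def)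
  then show "stationary_solution h0 (\<lambda>x. e1)"
    by (rule classical_solution_stationary)
  show "(\<lambda>x. e1) \<in> H1"
    by (rule classical_solution_H1[OF classical]) (simp_all add: axis_def)
qed

lemma nonconstant_stationary_solution_iff:
  assumes "h0 > -1"
  shows "w \<in> H1 \<and> stationary_solution h0 w \<and> (w \<longlongrightarrow> e1) at_bot \<and> \<not> w constant_on UNIV
    \<longleftrightarrow> (\<exists>g. w = act g (wall h0))"
proof
  assume L: "w \<in> H1 \<and> stationary_solution h0 w \<and> (w \<longlongrightarrow> e1) at_bot \<and> \<not> w constant_on UNIV"
  then have "w \<noteq> (\<lambda>x. e1)"
    by (auto simp: constant_on_def)
  with L stationary_solution_cases[of w h0] show "\<exists>g. w = act g (wall h0)" by blast
next
  assume "\<exists>g. w = act g (wall h0)"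
  then show "w \<in> H1 \<and> stationary_solution h0 w \<and> (w \<longlongrightarrow> e1) at_bot \<and> \<not> w constant_on UNIV"
    using act_wall[OF assms] by blast
qed

text \<open>For h0 = 0 only exp (-x) remains in \<open>zeta\<close>, which is the cotangent of half
  the angle \<open>theta_star x\<close>; the double angle formulas then give both
  coordinates.\<close>

lemma domain_wall_eq: "domain_wall = wall 0"
proof
  fix x :: real
  define a e where "a = arctan (exp x)" and "e = exp x"
  have e: "e > 0" "1 + e\<^sup>2 \<noteq> 0"
    using one_plus_sq_pos[of e] by (simp_all add: e_def)
  have "cos a > 0"
    unfolding a_def by (rule cos_gt_zero_pi) (use arctan_bounded[of "exp x"] in auto)
  moreover have "tan a = e"
    unfolding a_def e_def by (rule tan_arctan)
  ultimately have sin: "sin a = e * cos a"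
    by (simp add: tan_def divide_eq_eq)
  then have "(cos a)\<^sup>2 * (1 + e\<^sup>2) = 1"
    using sin_cos_squared_add[of a] by algebra
  then have cos: "(cos a)\<^sup>2 = 1 / (1 + e\<^sup>2)"
    using e(2) by (simp add: eq_divide_eq)
  have z: "zeta 0 x = 1 / e"
    by (simp add: zeta_def e_def exp_minus inverse_eq_divide)
  have q: "1 + (1 / e)\<^sup>2 = (1 + e\<^sup>2) / e\<^sup>2"
    using e(1) by (simp add: field_simps)
  have "cos (2 * a) = (1 - e\<^sup>2) * (cos a)\<^sup>2"
    unfolding cos_double sin by algebra
  also have "\<dots> = 1 - 2 / (1 + (zeta 0 x)\<^sup>2)"
    unfolding z q cos using e by (simp add: field_simps)
  finally have 1: "cos (2 * a) = 1 - 2 / (1 + (zeta 0 x)\<^sup>2)" .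
  have "sin (2 * a) = 2 * e * (cos a)\<^sup>2"
    unfolding sin_double sin by algebra
  also have "\<dots> = 2 * zeta 0 x / (1 + (zeta 0 x)\<^sup>2)"
    unfolding z q cos using e by (simp add: field_simps power2_eq_square)
  finally have 2: "sin (2 * a) = 2 * zeta 0 x / (1 + (zeta 0 x)\<^sup>2)" .
  show "domain_wall x = wall 0 x"
    unfolding domain_wall_def theta_star_def wall_def a_def[symmetric] 1 2 ..
qed

theorem theorem1p2:
  fixes \<alpha> h0 :: real
  assumes "\<alpha> > 0"
  shows
    "(h0 \<le> -1 \<longrightarrow>
       (\<forall>w. w \<in> H1 \<and> stationary_solution h0 w \<and> (w \<longlongrightarrow> e1) at_bot \<longleftrightarrow> w = (\<lambda>x. e1)))
     \<and>
     (h0 = 0 \<longrightarrow>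
       (\<forall>w. w \<in> H1 \<and> stationary_solution h0 w \<and> (w \<longlongrightarrow> e1) at_bot \<and> \<not> w constant_on UNIV
            \<longleftrightarrow> (\<exists>g. w = act g domain_wall)))
     \<and>
     (h0 \<in> {-1<..<0} \<or> h0 > 0 \<longrightarrow>
       (\<exists>w. w \<in> H1 \<and> stationary_solution h0 w \<and> (w \<longlongrightarrow> e1) at_bot \<and> \<not> w constant_on UNIV \<and>
          (\<forall>v. v \<in> H1 \<and> stationary_solution h0 v \<and> (v \<longlongrightarrow> e1) at_bot \<and> \<not> v constant_on UNIV
               \<longrightarrow> (\<exists>g. v = act g w))))"
proof (intro conjI impI allI)
  fix w
  assume "h0 \<le> -1"
  then show "w \<in> H1 \<and> stationary_solution h0 w \<and> (w \<longlongrightarrow> e1) at_bot \<longleftrightarrow> w = (\<lambda>x. e1)"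
    using stationary_solution_cases[of w h0] constant_solution by auto
next
  fix w
  assume "h0 = 0"
  then show "w \<in> H1 \<and> stationary_solution h0 w \<and> (w \<longlongrightarrow> e1) at_bot \<and> \<not> w constant_on UNIV
      \<longleftrightarrow> (\<exists>g. w = act g domain_wall)"
    unfolding domain_wall_eq using nonconstant_stationary_solution_iff[of h0 w] by simp
next
  assume "h0 \<in> {-1<..<0} \<or> h0 > 0"
  then have h0: "h0 > -1" by auto
  \<comment> \<open>The neutral element puts \<open>wall h0\<close> into its own orbit, so the
    equivalence yields existence as well as uniqueness.\<close>
  have "act (0, 0) (wall h0) = wall h0"
    by (simp add: fun_eq_iff act_def vec_eq_iff forall_3)
  then have "\<exists>g. wall h0 = act g (wall h0)" by metis
  with nonconstant_stationary_solution_iff[OF h0]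
  show "\<exists>w. w \<in> H1 \<and> stationary_solution h0 w \<and> (w \<longlongrightarrow> e1) at_bot \<and> \<not> w constant_on UNIV \<and>
      (\<forall>v. v \<in> H1 \<and> stationary_solution h0 v \<and> (v \<longlongrightarrow> e1) at_bot \<and> \<not> v constant_on UNIV
        \<longrightarrow> (\<exists>g. v = act g w))"
    by (intro exI[of _ "wall h0"]) blast
qed

end
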